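(* There exists a Toeplitz subshift whose automorphism group is (isomorphic to) the additive subgroup \[ \left(\left\langle (5/2)^i \;\middle|\; i \in \mathbb{N} \right\rangle, +\right) \leq (\mathbb{Q}, +), \] i.e. the subgroup of the additive group of rational numbers generated by the powers $(5/2)^i$, $i \in \mathbb{N}$.
   Context: Let $S$ be a finite alphabet with the discrete topology and give $S^{\mathbb{Z}}$ the product topology. The shift map is $\sigma(x)_i = x_{i+1}$. A subshift is a topologically closed $X \subset S^{\mathbb{Z}}$ with $\sigma(X) = X$. A Toeplitz point is $x \in S^{\mathbb{Z}}$ such that for every $i \in \mathbb{Z}$ there is $p > 0$ with $x_{i+kp} = x_i$ for all $k \in \mathbb{Z}$. A Toeplitz subshift is the orbit closure $\overline{\{\sigma^i(x) \mid i \in \mathbb{Z}\}}$ of a Toeplitz point $x$. An endomorphism of a subshift $X$ is a continuous map $f : X \to X$ with $f \circ \sigma = \sigma \circ f$; an automorphism is an endomorphism that is a homeomorphism. The automorphisms form a group under composition, the automorphism group of $X$. Here $0 \in \mathbb{N}$. *)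

theory Defs
  imports "HOL-Analysis.Analysis" "HOL-Algebra.Elementary_Groups"
begin

(* This notation of HOL-Algebra.Congruence clashes with the infix topological closure operator. *)
no_notation eq_closure_of (\<open>closure'_of\<index>\<close>)

definition full_shift :: "'a set \<Rightarrow> (int \<Rightarrow> 'a) topology" where
  "full_shift S = product_topology (\<lambda>_. discrete_topology S) UNIV"

definition shift :: "(int \<Rightarrow> 'a) \<Rightarrow> int \<Rightarrow> 'a" where
  "shift x = (\<lambda>i. x (i + 1))"

(* The k-th iterate of the shift for an arbitrary integer k; the closed form is justified by
   shift_iter_of_nat and shift_iter_minus below. *)
definition shift_iter :: "int \<Rightarrow> (int \<Rightarrow> 'a) \<Rightarrow> int \<Rightarrow> 'a" where
  "shift_iter k x = (\<lambda>i. x (i + k))"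

definition subshift :: "'a set \<Rightarrow> (int \<Rightarrow> 'a) set \<Rightarrow> bool" where
  "subshift S X \<longleftrightarrow> closedin (full_shift S) X \<and> shift ` X = X"

definition toeplitz_point :: "'a set \<Rightarrow> (int \<Rightarrow> 'a) \<Rightarrow> bool" where
  "toeplitz_point S x \<longleftrightarrow>
     x \<in> topspace (full_shift S) \<and> (\<forall>i. \<exists>p>0. \<forall>k. x (i + k * p) = x i)"

definition toeplitz_subshift :: "'a set \<Rightarrow> (int \<Rightarrow> 'a) set \<Rightarrow> bool" where
  "toeplitz_subshift S X \<longleftrightarrow>
     (\<exists>x. toeplitz_point S x \<and> X = full_shift S closure_of {shift_iter i x |i. True})"

definition shift_endomorphism ::
  "'a set \<Rightarrow> (int \<Rightarrow> 'a) set \<Rightarrow> ((int \<Rightarrow> 'a) \<Rightarrow> (int \<Rightarrow> 'a)) \<Rightarrow> bool" where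
  "shift_endomorphism S X f \<longleftrightarrow>
     continuous_map (subtopology (full_shift S) X) (subtopology (full_shift S) X) f \<and>
     (\<forall>x\<in>X. f (shift x) = shift (f x))"

definition shift_automorphism ::
  "'a set \<Rightarrow> (int \<Rightarrow> 'a) set \<Rightarrow> ((int \<Rightarrow> 'a) \<Rightarrow> (int \<Rightarrow> 'a)) \<Rightarrow> bool" where
  "shift_automorphism S X f \<longleftrightarrow>
     shift_endomorphism S X f \<and>
     homeomorphic_map (subtopology (full_shift S) X) (subtopology (full_shift S) X) f"

(* As in BijGroup, maps are taken extensional on X, so that each map X -> X is represented by
   exactly one HOL function, and the operation is composition of maps. *)
definition automorphism_group ::
  "'a set \<Rightarrow> (int \<Rightarrow> 'a) set \<Rightarrow> ((int \<Rightarrow> 'a) \<Rightarrow> (int \<Rightarrow> 'a)) monoid" where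
  "automorphism_group S X =
     \<lparr>carrier = {f \<in> extensional X. shift_automorphism S X f},
      mult = compose X,
      one = (\<lambda>x\<in>X. x)\<rparr>"

definition rational_group :: "rat monoid" where
  "rational_group = \<lparr>carrier = UNIV, mult = (+), one = 0\<rparr>"


lemma topspace_full_shift: "topspace (full_shift S) = {x. range x \<subseteq> S}"
  by (auto simp: full_shift_def PiE_def)

lemma shift_iter_of_nat: "shift_iter (int n) = shift ^^ n"
  by (induction n) (simp_all add: fun_eq_iff shift_iter_def shift_def ac_simps)

lemma shift_iter_minus: "shift_iter (- k) (shift_iter k x) = x"
  by (simp add: shift_iter_def)

lemma group_rational_group: "group rational_group"
  unfolding rational_group_def
proof (rule groupI, goal_cases)
  case (5 x)
  show ?case
    by (rule bexI[of _ "- x"]) simp_all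
qed simp_all

lemma continuous_map_shift_iter: "continuous_map (full_shift S) (full_shift S) (shift_iter k)"
  unfolding full_shift_def shift_iter_def
  by (auto simp: continuous_map_componentwise_UNIV intro: continuous_map_product_projection)

lemma homeomorphic_map_shift: "homeomorphic_map (full_shift S) (full_shift S) shift"
proof -
  have "homeomorphic_maps (full_shift S) (full_shift S) (shift_iter 1) (shift_iter (- 1))"
    using continuous_map_shift_iter[of S 1] continuous_map_shift_iter[of S "- 1"]
    by (auto simp: homeomorphic_maps_def shift_iter_def)
  moreover have "shift_iter 1 = (shift :: (int \<Rightarrow> 'a) \<Rightarrow> _)"
    by (simp add: fun_eq_iff shift_iter_def shift_def)
  ultimately show ?thesis
    by (metis homeomorphic_map_maps)
qed

lemma toeplitz_subshift_imp_subshift: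
  assumes "toeplitz_subshift S X"
  shows "subshift S X"
proof -
  obtain x where x: "toeplitz_point S x"
    and X: "X = full_shift S closure_of {shift_iter i x |i. True}"
    using assms by (auto simp: toeplitz_subshift_def)
  let ?O = "{shift_iter i x |i. True}"
  have sub: "?O \<subseteq> topspace (full_shift S)"
    using x by (auto simp: toeplitz_point_def topspace_full_shift shift_iter_def)
  have "shift (shift_iter i x) = shift_iter (i + 1) x" for i
    by (simp add: fun_eq_iff shift_iter_def shift_def ac_simps)
  moreover have "shift_iter i x = shift (shift_iter (i - 1) x)" for i
    by (simp add: fun_eq_iff shift_iter_def shift_def algebra_simps)
  ultimately have "shift ` ?O = ?O"
    by blast
  then have "shift ` X = X"
    using homeomorphic_map_closure_of[OF homeomorphic_map_shift sub] X by simp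
  then show ?thesis
    by (simp add: subshift_def X)
qed

lemma group_automorphism_group:
  assumes "subshift S X"
  shows "group (automorphism_group S X)"
proof -
  let ?T = "subtopology (full_shift S) X"
  have top: "topspace ?T = X"
    using assms by (auto simp: subshift_def dest: closedin_subset)
  have shiftX: "shift x \<in> X" if "x \<in> X" for x
    using assms that by (auto simp: subshift_def)
  have memX: "f x \<in> X" if "shift_automorphism S X f" "x \<in> X" for f x
    using that homeomorphic_imp_surjective_map[of ?T ?T f] top
    by (auto simp: shift_automorphism_def)
  have aut_cong: "shift_automorphism S X g"
    if "shift_automorphism S X f" "\<And>x. x \<in> X \<Longrightarrow> g x = f x" for f g
    using that shiftX homeomorphic_map_eq[of ?T ?T f g] top
    by (auto simp: shift_automorphism_def shift_endomorphism_def
        intro: homeomorphic_imp_continuous_map)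
  have comp: "shift_automorphism S X (compose X f g)"
    if "shift_automorphism S X f" "shift_automorphism S X g" for f g
  proof (rule aut_cong)
    show "shift_automorphism S X (f \<circ> g)"
      using that memX[OF that(2)]
      by (auto simp: shift_automorphism_def shift_endomorphism_def
          intro: homeomorphic_map_compose continuous_map_compose)
  qed (simp add: compose_def)
  have id: "shift_automorphism S X (\<lambda>x\<in>X. x)"
  proof (rule aut_cong)
    show "shift_automorphism S X (\<lambda>x. x)"
      by (simp add: shift_automorphism_def shift_endomorphism_def homeomorphic_eq_everything_map
          open_map_def closed_map_def)
  qed simp
  have inv: "\<exists>g. g \<in> extensional X \<and> shift_automorphism S X g \<and> compose X g f = (\<lambda>x\<in>X. x)"
    if f: "shift_automorphism S X f" for f
  proof -
    obtain g where g: "homeomorphic_maps ?T ?T f g"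
      using f by (auto simp: shift_automorphism_def homeomorphic_map_maps)
    then have gh: "homeomorphic_map ?T ?T g" and gf: "\<And>x. x \<in> X \<Longrightarrow> g (f x) = x"
      and fg: "\<And>x. x \<in> X \<Longrightarrow> f (g x) = x"
      using top by (auto simp: homeomorphic_maps_map)
    have gX: "g x \<in> X" if "x \<in> X" for x
      using homeomorphic_imp_surjective_map[OF gh] top that by auto
    have "g (shift x) = shift (g x)" if "x \<in> X" for x
    proof -
      have "f (shift (g x)) = shift x"
        using f gX fg that by (simp add: shift_automorphism_def shift_endomorphism_def)
      then show ?thesis
        using gf[of "shift (g x)"] gX shiftX that by simp
    qed
    then have "shift_automorphism S X g"
      using gh by (auto simp: shift_automorphism_def shift_endomorphism_def
          intro: homeomorphic_imp_continuous_map)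
    then have "shift_automorphism S X (restrict g X)"
      by (rule aut_cong) simp
    moreover have "compose X (restrict g X) f = (\<lambda>x\<in>X. x)"
      using memX[OF f] gf by (auto simp: compose_def fun_eq_iff)
    ultimately show ?thesis
      by blast
  qed
  show ?thesis
    unfolding automorphism_group_def
  proof (rule groupI, goal_cases)
    case (3 f g h)
    then show ?case
      using memX by (auto simp: compose_def fun_eq_iff)
  next
    case (4 f)
    then show ?case
      using memX by (auto simp: compose_def fun_eq_iff extensional_def)
  next
    case (5 f)
    then show ?case
      using inv by auto
  qed (use comp id in auto)
qed

end

theory Submission
  imports Defs
begin

text \<open>
  The Toeplitz point is the fixed point \<open>x\<close> of the map \<open>F = fill\<close> which writes a sequence
  into the holes of the periodic pattern \<open>(0 ? 2 ? 4)\<close> of length 5. Since each period has two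
  holes, \<open>F \<circ> \<sigma>\<^sup>2 = \<sigma>\<^sup>5 \<circ> F\<close>, and every point of the orbit closure \<open>X\<close> has the form
  \<open>\<sigma>\<^sup>j (F\<^sup>k y)\<close> with \<open>y \<in> X\<close> and \<open>j\<close> unique modulo \<open>5\<^sup>k\<close>. Hence
  \<open>\<sigma>\<^sup>j (F\<^sup>k y) \<mapsto> \<sigma>\<^sup>j (F\<^sup>k (\<sigma> y))\<close> is a well-defined automorphism whose \<open>2\<^sup>k\<close>-th power is \<open>\<sigma>\<close>
  to the \<open>5\<^sup>k\<close>: it plays the role of \<open>(5/2)\<^sup>k\<close>.

  Conversely, let \<open>f\<close> be an automorphism of radius \<open>r\<close> and write \<open>f x = \<sigma>\<^sup>t (F\<^sup>k y)\<close>. The holes of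
  level \<open>k\<close> are at distance at least \<open>2\<^sup>k\<close>, so for \<open>2\<^sup>k > 2 r\<close> each hole of \<open>f x\<close> has exactly one
  hole of \<open>x\<close> within distance \<open>r\<close>. Thus \<open>y i\<close> depends only on \<open>i mod 2\<^sup>k\<close> and \<open>x (i + c)\<close> for some constant \<open>c\<close>; as 2 and
  5 are coprime, this forces \<open>y = \<sigma>\<^sup>c x\<close>, so \<open>f\<close> is a product of the automorphisms above.
\<close>

subsection \<open>Groups generated by roots of a central element\<close>

text \<open>The hypotheses make \<open>a k c\<close> behave like \<open>c * (5/2) ^ k\<close>, with
  \<open>a 0\<close> playing the integers. The isomorphism sends \<open>f\<close> to
  \<open>m / n\<close> whenever \<open>f [^] n = a 0 m\<close> with \<open>n > 0\<close>.
  \<open>cover\<close> speaks of all large levels, so that two elements can be written at one common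
  level.\<close>

lemma (in group) dyadic_roots_iso:
  fixes a :: "nat \<Rightarrow> int \<Rightarrow> 'a"
  assumes closed: "\<And>k c. a k c \<in> carrier G"
    and add: "\<And>k c d. a k (c + d) = a k c \<otimes> a k d"
    and central: "\<And>f c. f \<in> carrier G \<Longrightarrow> a 0 c \<otimes> f = f \<otimes> a 0 c"
    and root: "\<And>k. a k (2 ^ k) = a 0 (5 ^ k)"
    and free: "\<And>c. a 0 c = \<one> \<Longrightarrow> c = 0"
    and cover: "\<And>f. f \<in> carrier G \<Longrightarrow> \<exists>K. \<forall>k\<ge>K. \<exists>t c. f = a 0 t \<otimes> a k c"
  shows "G \<cong> subgroup_generated rational_group {(5 / 2) ^ i |i :: nat. True}"
proof -
  define B where "B = (range (\<lambda>i. (5 / 2) ^ i) :: rat set)"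
  define R where "R = subgroup_generated rational_group B"
  have zero: "a k 0 = \<one>" for k
    using add[of k 0 0] closed[of k 0] by simp
  have pow: "a k c [^] n = a k (c * int n)" for k c and n :: nat
    by (induction n) (simp_all add: zero add[symmetric] algebra_simps)
  have neg: "a k (- c) = inv (a k c)" for k c
    using add[of k "- c" c] closed by (simp add: zero inv_equality)
  have root_mult: "a k (c * 2 ^ k) = a 0 (c * 5 ^ k)" for k c
  proof -
    have nonneg: "a k (int n * 2 ^ k) = a 0 (int n * 5 ^ k)" for n
      using pow[of k "2 ^ k" n] pow[of 0 "5 ^ k" n] by (simp add: root mult.commute)
    show ?thesis
    proof (cases "c \<ge> 0")
      case True
      then show ?thesis using nonneg[of "nat c"] by simp
    next
      case False
      then show ?thesis
        using nonneg[of "nat (- c)"] neg[of k "- c * 2 ^ k"] neg[of 0 "- c * 5 ^ k"] by simp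
    qed
  qed
  have inj0: "c = d" if "a 0 c = a 0 d" for c d
    using free[of "c - d"] add[of 0 "c - d" d] that closed by simp
  \<comment> \<open>At a common level the factors \<open>a ?k c\<close> and \<open>a ?k d\<close>
    commute by \<open>add\<close>, and the factors \<open>a 0 t\<close> are central.\<close>
  have comm: "f \<otimes> g = g \<otimes> f" if fg: "f \<in> carrier G" "g \<in> carrier G" for f g
  proof -
    obtain K where K: "\<And>k. k \<ge> K \<Longrightarrow> \<exists>t c. f = a 0 t \<otimes> a k c" using cover[OF fg(1)] by blast
    obtain L where L: "\<And>k. k \<ge> L \<Longrightarrow> \<exists>t c. g = a 0 t \<otimes> a k c" using cover[OF fg(2)] by blast
    let ?k = "max K L"
    obtain t c where f: "f = a 0 t \<otimes> a ?k c" using K[of ?k] by auto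
    obtain s d where g: "g = a 0 s \<otimes> a ?k d" using L[of ?k] by auto
    have prod: "(a 0 t \<otimes> a ?k c) \<otimes> (a 0 s \<otimes> a ?k d) = a 0 (t + s) \<otimes> a ?k (c + d)" for t c s d
    proof -
      have "(a 0 t \<otimes> a ?k c) \<otimes> (a 0 s \<otimes> a ?k d) = a 0 t \<otimes> (a ?k c \<otimes> a 0 s) \<otimes> a ?k d"
        using closed by (simp add: m_assoc)
      also have "\<dots> = a 0 t \<otimes> (a 0 s \<otimes> a ?k c) \<otimes> a ?k d"
        using central[OF closed] by simp
      finally show ?thesis using closed by (simp add: add m_assoc)
    qed
    show ?thesis unfolding f g prod by (simp add: add.commute)
  qed
  have powmult: "(f \<otimes> g) [^] n = f [^] n \<otimes> g [^] n"
    if "f \<in> carrier G" "g \<in> carrier G" for f g and n :: nat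
    using that comm by (intro pow_mult_distrib) auto
  define rel where "rel f q \<longleftrightarrow> (\<exists>(n::nat) m. n > 0 \<and> f [^] n = a 0 m \<and> q = of_int m / of_nat n)"
    for f and q :: rat
  define rho where "rho f = (THE q. rel f q)" for f
  \<comment> \<open>Raising both relations to a common exponent gives two values of
    \<open>a 0\<close> that agree, and \<open>a 0\<close> is injective.\<close>
  have rel_unique: "q = q'" if rels: "rel f q" "rel f q'" and f: "f \<in> carrier G" for f q q'
  proof -
    obtain n m where n: "n > 0" "f [^] n = a 0 m" "q = of_int m / of_nat n"
      using rels(1) unfolding rel_def by blast
    obtain n' m' where n': "n' > 0" "f [^] n' = a 0 m'" "q' = of_int m' / of_nat n'"
      using rels(2) unfolding rel_def by blast
    have "a 0 (m * int n') = (f [^] n) [^] n'" by (simp add: n(2) pow)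
    also have "\<dots> = (f [^] n') [^] n" using f by (simp add: nat_pow_pow mult.commute)
    also have "\<dots> = a 0 (m' * int n)" by (simp add: n'(2) pow)
    finally have "m * int n' = m' * int n" by (rule inj0)
    then have "(of_int (m * int n') :: rat) = of_int (m' * int n)" by simp
    then have "of_int m * of_nat n' = (of_int m' * of_nat n :: rat)" by simp
    then show ?thesis unfolding n(3) n'(3) using n(1) n'(1) by (simp add: frac_eq_eq)
  qed
  have rel_form: "rel (a 0 t \<otimes> a k c) (of_int t + of_int c * (5 / 2) ^ k)" for t k c
  proof -
    have "a k (c * 2 ^ k) = a 0 (c * 5 ^ k)" by (rule root_mult)
    then have "(a 0 t \<otimes> a k c) [^] (2 ^ k :: nat) = a 0 (t * 2 ^ k + c * 5 ^ k)"
      using closed by (simp add: powmult pow add)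
    then show ?thesis
      unfolding rel_def
      by (intro exI[of _ "2 ^ k"] exI[of _ "t * 2 ^ k + c * 5 ^ k"])
        (simp add: add_divide_distrib power_divide)
  qed
  have rhoI: "rho f = q" if "rel f q" "f \<in> carrier G" for f q
    unfolding rho_def using that rel_unique by blast
  have form: "\<exists>t k c. f = a 0 t \<otimes> a k c \<and> rho f = of_int t + of_int c * (5 / 2) ^ k"
    if f: "f \<in> carrier G" for f
  proof -
    obtain t k c where "f = a 0 t \<otimes> a k c" using cover[OF f] by blast
    with rel_form rhoI f show ?thesis by blast
  qed
  have rel_rho: "rel f (rho f)" if f: "f \<in> carrier G" for f
    using form[OF f] rel_form by metis
  have rho_mult: "rho (f \<otimes> g) = rho f + rho g" if fg: "f \<in> carrier G" "g \<in> carrier G" for f g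
  proof (rule rhoI)
    obtain n m where n: "n > 0" "f [^] n = a 0 m" "rho f = of_int m / of_nat n"
      using rel_rho[OF fg(1)] unfolding rel_def by blast
    obtain n' m' where n': "n' > 0" "g [^] n' = a 0 m'" "rho g = of_int m' / of_nat n'"
      using rel_rho[OF fg(2)] unfolding rel_def by blast
    have "(f \<otimes> g) [^] (n * n') = (f [^] n) [^] n' \<otimes> (g [^] n') [^] n"
      using fg by (simp add: powmult nat_pow_pow mult.commute)
    also have "\<dots> = a 0 (m * int n' + m' * int n)" by (simp add: n n' pow add)
    finally show "rel (f \<otimes> g) (rho f + rho g)"
      unfolding rel_def using n n'
      by (intro exI[of _ "n * n'"] exI[of _ "m * int n' + m' * int n"]) (simp add: field_simps)
  qed (use fg in simp)
  \<comment> \<open>If \<open>t + c * (5/2) ^ k = 0\<close>, then \<open>2 ^ k\<close> divides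
    \<open>c\<close> because it is coprime to \<open>5 ^ k\<close>. So \<open>a k c\<close> is
    already a value of \<open>a 0\<close>, and it cancels \<open>a 0 t\<close>.\<close>
  have rho_trivial: "f = \<one>" if f: "f \<in> carrier G" "rho f = 0" for f
  proof -
    obtain t k c where tk: "f = a 0 t \<otimes> a k c" "0 = of_int t + of_int c * (5 / 2 :: rat) ^ k"
      using form[OF f(1)] f(2) by auto
    then have "(of_int (t * 2 ^ k + c * 5 ^ k) :: rat) = of_int 0"
      by (simp add: power_divide field_simps)
    then have E: "t * 2 ^ k + c * 5 ^ k = 0" by (simp only: of_int_eq_iff)
    then have "2 ^ k dvd c * 5 ^ k" by (metis dvd_0_right dvd_add_right_iff dvd_triv_right)
    moreover have "coprime (2 ^ k) (5 ^ k :: int)" by simp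
    ultimately have "2 ^ k dvd c" by (simp add: coprime_dvd_mult_left_iff)
    then obtain d where c: "c = 2 ^ k * d" by auto
    have "2 ^ k * (t + d * 5 ^ k) = 0" using E by (simp add: c algebra_simps)
    then have t: "t = - (d * 5 ^ k)" by simp
    show ?thesis
      using root_mult[of k d] zero[of 0] add[of 0 t "- t"]
      by (simp add: tk(1) c t mult.commute)
  qed
  have gens: "(5 / 2) ^ k \<in> B" for k by (simp add: B_def)
  have car: "carrier R = generate rational_group B"
    by (simp add: R_def subgroup_generated_def rational_group_def)
  interpret Q: group rational_group by (rule group_rational_group)
  interpret R: group R by (simp add: R_def)
  have Qops: "x \<otimes>\<^bsub>rational_group\<^esub> y = x + y" "\<one>\<^bsub>rational_group\<^esub> = 0" "carrier rational_group = UNIV" for x y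
    by (simp_all add: rational_group_def)
  have Rops: "x \<otimes>\<^bsub>R\<^esub> y = x + y" "\<one>\<^bsub>R\<^esub> = 0" for x y
    by (simp_all add: R_def subgroup_generated_def rational_group_def)
  have Qinv: "inv\<^bsub>rational_group\<^esub> x = - x" for x
    by (rule Q.inv_equality) (simp_all add: Qops)
  have sub: "subgroup (carrier R) rational_group"
    unfolding car by (rule Q.generate_is_subgroup) (simp add: Qops)
  have plus: "x + y \<in> carrier R" if "x \<in> carrier R" "y \<in> carrier R" for x y
    using subgroup.m_closed[OF sub that] by (simp add: Qops)
  have minus: "- x \<in> carrier R" if "x \<in> carrier R" for x
    using subgroup.m_inv_closed[OF sub that] by (simp add: Qinv)
  have zero_R: "0 \<in> carrier R"
    using subgroup.one_closed[OF sub] by (simp add: Qops)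
  have gen_R: "(5 / 2) ^ k \<in> carrier R" for k
    unfolding car by (rule generate.incl[OF gens])
  have nat_mult: "of_nat n * x \<in> carrier R" if "x \<in> carrier R" for n x
    using that by (induction n) (simp_all add: zero_R distrib_right plus)
  have int_mult: "of_int c * x \<in> carrier R" if "x \<in> carrier R" for c x
    using nat_mult[OF that, of "nat c"] minus[OF nat_mult[OF that, of "nat (- c)"]]
    by (cases "c \<ge> 0") simp_all
  \<comment> \<open>The integer part lies in the subgroup because \<open>(5/2) ^ 0 = 1\<close> is a
    generator.\<close>
  have into: "rho f \<in> carrier R" if f: "f \<in> carrier G" for f
  proof -
    obtain t k c where "rho f = of_int t + of_int c * (5 / 2) ^ k" using form[OF f] by blast
    then show ?thesis
      using plus[OF int_mult[OF gen_R[of 0], of t] int_mult[OF gen_R[of k], of c]] by simp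
  qed
  have hom: "rho \<in> hom G R"
    by (rule homI) (simp_all add: into rho_mult Rops)
  interpret H: group_hom G R rho
    using hom by unfold_locales
  have "inj_on rho (carrier G)"
    by (rule H.inj_on_one_iff[THEN iffD2]) (use rho_trivial in \<open>simp add: Rops\<close>)
  moreover have "carrier R \<subseteq> rho ` carrier G"
  proof
    fix q
    assume "q \<in> carrier R"
    then show "q \<in> rho ` carrier G"
      unfolding car
    proof (induction rule: generate.induct)
      case one
      then show ?case using H.hom_one by (force simp: Qops Rops)
    next
      case (incl h)
      then obtain k where h: "h = (5 / 2) ^ k" by (auto simp: B_def)
      then have "rho (a 0 0 \<otimes> a k 1) = h"
        using rel_form[of 0 k 1] closed by (intro rhoI) (simp_all add: h)
      then show ?case using closed by blast
    next
      case (inv h)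
      then obtain k where h: "h = (5 / 2) ^ k" by (auto simp: B_def)
      then have "rho (a 0 0 \<otimes> a k (- 1)) = - h"
        using rel_form[of 0 k "- 1"] closed by (intro rhoI) (simp_all add: h)
      then show ?case using closed by (metis Qinv image_eqI m_closed)
    next
      case (eng g h)
      then obtain f f' where "f \<in> carrier G" "f' \<in> carrier G" "g = rho f" "h = rho f'" by blast
      then show ?case using rho_mult[of f f'] by (metis Qops(1) image_eqI m_closed)
    qed
  qed
  ultimately have "rho \<in> iso G R"
    using hom into by (auto simp: iso_def bij_betw_def)
  then show ?thesis
    by (auto simp: R_def B_def full_SetCompr_eq intro: is_isoI)
qed

subsection \<open>The topology of full shifts\<close>

text \<open>A basic open set of the product restricts finitely many coordinates, and these fit into
  a window around 0. Conversely, discreteness of the factors makes the sets given by a window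
  open.\<close>

lemma openin_full_shift:
  "openin (full_shift S) U \<longleftrightarrow> U \<subseteq> {u. range u \<subseteq> S} \<and>
     (\<forall>u\<in>U. \<exists>N. \<forall>v. range v \<subseteq> S \<and> (\<forall>i. \<bar>i\<bar> \<le> N \<longrightarrow> v i = u i) \<longrightarrow> v \<in> U)"
  (is "?lhs \<longleftrightarrow> ?rhs")
proof
  assume L: ?lhs
  have "\<forall>u\<in>U. \<exists>N. \<forall>v. range v \<subseteq> S \<and> (\<forall>i. \<bar>i\<bar> \<le> N \<longrightarrow> v i = u i) \<longrightarrow> v \<in> U"
  proof
    fix u
    assume "u \<in> U"
    obtain V where fin: "finite {i. V i \<noteq> S}" and u: "\<And>i. u i \<in> V i" and V: "Pi\<^sub>E UNIV V \<subseteq> U"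
      using bspec[OF L[unfolded full_shift_def openin_product_topology_alt] \<open>u \<in> U\<close>] by (auto simp: PiE_iff)
    \<comment> \<open>Inserting 0 keeps the set nonempty when no coordinate is restricted.\<close>
    define N where "N = Max (insert 0 (abs ` {i. V i \<noteq> S}))"
    have N: "\<bar>i\<bar> \<le> N" if "V i \<noteq> S" for i
      unfolding N_def using fin that by (intro Max_ge) auto
    have "v \<in> U" if "range v \<subseteq> S" "\<forall>i. \<bar>i\<bar> \<le> N \<longrightarrow> v i = u i" for v
    proof -
      have "v i \<in> V i" for i
        using N[of i] u[of i] that by (cases "V i = S") auto
      then show ?thesis using V by (auto simp: PiE_iff)
    qed
    then show "\<exists>N. \<forall>v. range v \<subseteq> S \<and> (\<forall>i. \<bar>i\<bar> \<le> N \<longrightarrow> v i = u i) \<longrightarrow> v \<in> U" by blast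
  qed
  moreover have "U \<subseteq> {u. range u \<subseteq> S}"
    using openin_subset[OF L] by (simp only: topspace_full_shift)
  ultimately show ?rhs by (rule conjI[rotated])
next
  assume R: ?rhs
  show ?lhs
    unfolding full_shift_def openin_product_topology_alt
  proof
    fix u
    assume u: "u \<in> U"
    from bspec[OF conjunct2[OF R] this]
    obtain N where N: "\<forall>v. range v \<subseteq> S \<and> (\<forall>i. \<bar>i\<bar> \<le> N \<longrightarrow> v i = u i) \<longrightarrow> v \<in> U" ..
    let ?V = "\<lambda>i. if \<bar>i\<bar> \<le> N then {u i} else S"
    have uS: "u i \<in> S" for i using subsetD[OF conjunct1[OF R] u] by auto
    have "finite {i \<in> UNIV. ?V i \<noteq> topspace (discrete_topology S)}"
      by (rule finite_subset[of _ "{- N..N}"]) auto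
    moreover have "Pi\<^sub>E UNIV ?V \<subseteq> U"
    proof
      fix v
      assume "v \<in> Pi\<^sub>E UNIV ?V"
      then have v: "v i \<in> ?V i" for i by (auto simp: PiE_iff)
      show "v \<in> U"
      proof (rule N[rule_format], intro conjI allI impI subsetI)
        show "v i = u i" if "\<bar>i\<bar> \<le> N" for i using v[of i] that by simp
        show "a \<in> S" if a: "a \<in> range v" for a
        proof -
          obtain i where "a = v i" using a by blast
          then show ?thesis using v[of i] uS[of i] by (auto split: if_splits)
        qed
      qed
    qed
    ultimately show "\<exists>V. finite {i \<in> UNIV. V i \<noteq> topspace (discrete_topology S)} \<and>
        (\<forall>i\<in>UNIV. openin (discrete_topology S) (V i)) \<and> u \<in> Pi\<^sub>E UNIV V \<and> Pi\<^sub>E UNIV V \<subseteq> U"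
      using uS by (intro exI[of _ ?V]) (auto simp: PiE_iff)
  qed
qed

lemma openin_full_shift_window:
  assumes "openin (full_shift S) U" "u \<in> U"
  obtains N where "\<forall>v. range v \<subseteq> S \<and> (\<forall>i. \<bar>i\<bar> \<le> N \<longrightarrow> v i = u i) \<longrightarrow> v \<in> U"
  using bspec[OF conjunct2[OF assms(1)[unfolded openin_full_shift]] assms(2)] by (rule exE)

lemma openin_window: "openin (full_shift S) {v. range v \<subseteq> S \<and> (\<forall>i. \<bar>i\<bar> \<le> N \<longrightarrow> v i = u i)}"
  unfolding openin_full_shift by (auto intro!: exI[of _ N])

lemma closure_of_orbit:
  assumes "range x \<subseteq> S"
  shows "full_shift S closure_of {shift_iter i x |i. True} =
    {u. \<forall>N. \<exists>m. \<forall>i. \<bar>i\<bar> \<le> N \<longrightarrow> u i = x (i + m)}" (is "?C = ?X")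
proof (rule Set.set_eqI, rule iffI)
  fix u
  assume "u \<in> ?C"
  then have u: "range u \<subseteq> S"
    and U: "\<And>U. u \<in> U \<Longrightarrow> openin (full_shift S) U \<Longrightarrow> \<exists>m. shift_iter m x \<in> U"
    by (auto simp: in_closure_of topspace_full_shift)
  show "u \<in> ?X"
  proof (intro CollectI allI)
    fix N
    have "u \<in> {v. range v \<subseteq> S \<and> (\<forall>i. \<bar>i\<bar> \<le> N \<longrightarrow> v i = u i)}" using u by blast
    from U[OF this openin_window] obtain m where "\<forall>i. \<bar>i\<bar> \<le> N \<longrightarrow> x (i + m) = u i"
      by (auto simp: shift_iter_def)
    then show "\<exists>m. \<forall>i. \<bar>i\<bar> \<le> N \<longrightarrow> u i = x (i + m)" by (intro exI[of _ m]) simp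
  qed
next
  fix u
  assume u: "u \<in> ?X"
  have "u i \<in> S" for i
  proof -
    obtain m where "u i = x (i + m)" using u by (auto dest: spec[of _ "\<bar>i\<bar>"])
    then show ?thesis using assms by auto
  qed
  moreover have "\<exists>m. shift_iter m x \<in> U" if "u \<in> U" "openin (full_shift S) U" for U
  proof -
    obtain N where N: "\<forall>v. range v \<subseteq> S \<and> (\<forall>i. \<bar>i\<bar> \<le> N \<longrightarrow> v i = u i) \<longrightarrow> v \<in> U"
      using openin_full_shift_window[OF \<open>openin (full_shift S) U\<close> \<open>u \<in> U\<close>] .
    obtain m where m: "\<And>i. \<bar>i\<bar> \<le> N \<Longrightarrow> u i = x (i + m)" using u by blast
    have "shift_iter m x \<in> U"
      by (rule N[rule_format]) (use assms m in \<open>auto simp: shift_iter_def\<close>)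
    then show ?thesis by blast
  qed
  ultimately show "u \<in> ?C"
    by (auto simp: in_closure_of topspace_full_shift) metis
qed

lemma compact_space_full_shift: "finite S \<Longrightarrow> compact_space (full_shift S)"
  by (simp add: full_shift_def compact_space_product_topology compact_space_discrete_topology)

lemma Hausdorff_space_full_shift: "Hausdorff_space (full_shift S)"
  by (simp add: full_shift_def Hausdorff_space_product_topology)

text \<open>The compactness half of the Curtis-Hedlund-Lyndon theorem: each point has a window that
  determines coordinate 0 of its image, finitely many such windows cover \<open>X\<close>, and the
  largest radius serves everywhere.\<close>

lemma continuous_map_local_rule:
  assumes X: "compactin (full_shift S) X"
    and f: "continuous_map (subtopology (full_shift S) X) (full_shift S) f"
  shows "\<exists>r. \<forall>u\<in>X. \<forall>v\<in>X. (\<forall>i. \<bar>i\<bar> \<le> r \<longrightarrow> u i = v i) \<longrightarrow> f u 0 = f v 0"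
proof -
  have XS: "range u \<subseteq> S" if "u \<in> X" for u
    using compactin_subset_topspace[OF X] that by (auto simp: topspace_full_shift)
  have "\<exists>N. \<forall>v\<in>X. (\<forall>i. \<bar>i\<bar> \<le> N \<longrightarrow> v i = u i) \<longrightarrow> f v 0 = f u 0" if u: "u \<in> X" for u
  proof -
    \<comment> \<open>Radius 0 prescribes only coordinate 0 of the image.\<close>
    let ?W = "{v. range v \<subseteq> S \<and> (\<forall>i. \<bar>i\<bar> \<le> 0 \<longrightarrow> v i = f u i)}"
    have "openin (subtopology (full_shift S) X)
        {v \<in> topspace (subtopology (full_shift S) X). f v \<in> ?W}"
      by (rule openin_continuous_map_preimage[OF f openin_window])
    then obtain T where T: "openin (full_shift S) T"
      "{v \<in> topspace (subtopology (full_shift S) X). f v \<in> ?W} = T \<inter> X"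
      by (auto simp: openin_subtopology)
    have fS: "range (f v) \<subseteq> S" if "v \<in> X" for v
      using continuous_map_image_subset_topspace[OF f] that XS[OF that]
      by (auto simp: topspace_full_shift)
    have "u \<in> {v \<in> topspace (subtopology (full_shift S) X). f v \<in> ?W}"
      using u XS fS by (auto simp: topspace_full_shift)
    then have "u \<in> T" using T(2) by blast
    from openin_full_shift_window[OF T(1) this]
    obtain N where N: "\<forall>v. range v \<subseteq> S \<and> (\<forall>i. \<bar>i\<bar> \<le> N \<longrightarrow> v i = u i) \<longrightarrow> v \<in> T" .
    have "f v 0 = f u 0" if "v \<in> X" "\<forall>i. \<bar>i\<bar> \<le> N \<longrightarrow> v i = u i" for v
    proof -
      have "v \<in> T \<inter> X" using N[rule_format, of v] XS[OF that(1)] that by auto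
      then have "f v \<in> ?W" unfolding T(2)[symmetric] by blast
      then show ?thesis by simp
    qed
    then show ?thesis by blast
  qed
  then obtain N where N: "\<And>u v. u \<in> X \<Longrightarrow> v \<in> X \<Longrightarrow> (\<And>i. \<bar>i\<bar> \<le> N u \<Longrightarrow> v i = u i) \<Longrightarrow> f v 0 = f u 0"
    by metis
  define C where "C u = {v. range v \<subseteq> S \<and> (\<forall>i. \<bar>i\<bar> \<le> N u \<longrightarrow> v i = u i)}" for u
  have "\<exists>\<F>. finite \<F> \<and> \<F> \<subseteq> C ` X \<and> X \<subseteq> \<Union>\<F>"
  proof (rule X[unfolded compactin_def, THEN conjunct2, rule_format], intro conjI ballI)
    show "openin (full_shift S) U" if "U \<in> C ` X" for U
      using that openin_window by (auto simp: C_def)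
    show "X \<subseteq> \<Union> (C ` X)" using XS by (auto simp: C_def)
  qed
  then obtain Y where Y: "finite Y" "Y \<subseteq> X" "X \<subseteq> \<Union> (C ` Y)"
    by (metis finite_subset_image)
  define r where "r = Max (insert 0 (N ` Y))"
  have "f u 0 = f v 0" if uv: "u \<in> X" "v \<in> X" "\<forall>i. \<bar>i\<bar> \<le> r \<longrightarrow> u i = v i" for u v
  proof -
    obtain w where w: "w \<in> Y" "u \<in> C w" using Y uv by blast
    have "N w \<le> r" unfolding r_def using Y w by (intro Max_ge) auto
    then have v: "v i = w i" if "\<bar>i\<bar> \<le> N w" for i using w uv that by (auto simp: C_def)
    have u: "u i = w i" if "\<bar>i\<bar> \<le> N w" for i using w that by (auto simp: C_def)
    have "f v 0 = f w 0" "f u 0 = f w 0"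
      using N[of w v] N[of w u] u v w Y uv by blast+
    then show ?thesis by simp
  qed
  then show ?thesis by blast
qed

subsection \<open>The filling map and its holes\<close>

text \<open>The fixed point of \<open>fill\<close>, evaluated by recursion: for
  \<open>n mod 5\<close> equal to 1 or 3, \<open>2 * n div 5\<close> is the index of the hole at
  position \<open>n\<close>, so the letter is looked up there.\<close>

function base_point :: "int \<Rightarrow> nat" where
  "base_point n = (if n mod 5 = 1 \<or> n mod 5 = 3 then base_point (2 * n div 5) else nat (n mod 5))"
  by auto
termination
proof (relation "Wellfounded.measure (\<lambda>n. nat \<bar>n\<bar>)")
  fix n :: int
  assume "n mod 5 = 1 \<or> n mod 5 = 3"
  \<comment> \<open>Only 0 and -1 fail to move closer to 0 under \<open>2 * n div 5\<close>, and
    neither is the position of a hole.\<close>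
  then have "n \<noteq> 0" "n \<noteq> - 1" by auto
  then have "\<bar>2 * n div 5\<bar> < \<bar>n\<bar>" by linarith
  then show "(2 * n div 5, n) \<in> Wellfounded.measure (\<lambda>n. nat \<bar>n\<bar>)" by simp
qed simp

declare base_point.simps [simp del]

definition fill :: "(int \<Rightarrow> nat) \<Rightarrow> int \<Rightarrow> nat" where
  "fill y n = (if n mod 5 = 1 \<or> n mod 5 = 3 then y (2 * n div 5) else nat (n mod 5))"

text \<open>The increasing enumeration of the integers congruent to 1 or 3 modulo 5, starting from
  \<open>hole 0 = 1\<close>.\<close>

definition hole :: "int \<Rightarrow> int" where
  "hole i = 5 * i div 2 + 1"

lemma fill_base_point: "fill base_point = base_point"
  by (rule ext) (simp add: fill_def base_point.simps[symmetric])

lemma funpow_fill_base_point: "(fill ^^ k) base_point = base_point"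
  by (induction k) (simp_all add: fill_base_point)

lemma hole_mod: "hole i mod 5 = 1 \<or> hole i mod 5 = 3"
  unfolding hole_def by presburger

lemma hole_div [simp]: "2 * hole i div 5 = i"
  unfolding hole_def by presburger

lemma hole_of_div:
  assumes "n mod 5 = 1 \<or> n mod 5 = 3"
  shows "hole (2 * n div 5) = n"
proof -
  define q where "q = n div 5"
  have "n = 5 * q + n mod 5" by (simp add: q_def)
  with assms consider "n = 5 * q + 1" | "n = 5 * q + 3" by fastforce
  then show ?thesis
  proof cases
    case 1
    have "2 * (5 * q + 1) div 5 = 2 * q" by presburger
    then show ?thesis by (simp add: 1 hole_def)
  next
    case 2
    have "2 * (5 * q + 3) div 5 = 2 * q + 1" by presburger
    then show ?thesis by (simp only: 2 hole_def) presburger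
  qed
qed

lemma fill_hole [simp]: "fill y (hole i) = y i"
  using hole_mod[of i] by (simp add: fill_def)

text \<open>Thus \<open>hole ^^ k\<close> enumerates the holes of level \<open>k\<close>, where
  \<open>fill ^^ k\<close> still shows its argument.\<close>

lemma funpow_fill_hole: "(fill ^^ k) y ((hole ^^ k) i) = y i"
  by (induction k arbitrary: y i) (simp_all add: funpow_swap1)

section \<open>Compatibility of filling and holes with translations\<close>

lemma double_div_add: "2 * (n + 5 * m) div 5 = 2 * n div 5 + 2 * (m :: int)"
proof -
  have "2 * (n + 5 * m) = 2 * n + 2 * m * 5" by simp
  then show ?thesis by (simp only: div_mult_self1 zero_neq_numeral[symmetric] not_False_eq_True)
qed

lemma fill_shift_iter: "fill (shift_iter (2 * m) y) = shift_iter (5 * m) (fill y)"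
proof
  fix n :: int
  show "fill (shift_iter (2 * m) y) n = shift_iter (5 * m) (fill y) n"
    by (simp add: fill_def shift_iter_def double_div_add del: distrib_left_numeral)
qed

lemma funpow_fill_shift_iter:
  "(fill ^^ k) (shift_iter (2 ^ k * m) y) = shift_iter (5 ^ k * m) ((fill ^^ k) y)"
proof (induction k arbitrary: m)
  case (Suc k)
  show ?case
    using Suc[of "2 * m"] fill_shift_iter[of "5 ^ k * m"] by (simp add: mult_ac)
qed simp

lemma hole_add: "hole (i + 2 * m) = hole i + 5 * m"
proof -
  have "5 * (i + 2 * m) = 5 * i + 5 * m * 2" by simp
  then have "5 * (i + 2 * m) div 2 = 5 * i div 2 + 5 * m"
    by (simp only: div_mult_self1 zero_neq_numeral[symmetric] not_False_eq_True)
  then show ?thesis by (simp add: hole_def)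
qed

lemma funpow_hole_add: "(hole ^^ k) (i + 2 ^ k * m) = (hole ^^ k) i + 5 ^ k * m"
proof (induction k arbitrary: m)
  case (Suc k)
  show ?case
    using Suc[of "2 * m"] hole_add[of _ "5 ^ k * m"] by (simp add: mult_ac)
qed simp

text \<open>Neighbouring holes are 2 or 3 apart. Iterating the lower bound 2 separates the holes of
  level \<open>k\<close> by at least \<open>2 ^ k\<close>.\<close>

lemma hole_gap: "i \<le> j \<Longrightarrow> hole i + 2 * (j - i) \<le> hole j"
proof -
  assume "i \<le> j"
  then have "i div 2 \<le> j div 2" by (rule zdiv_mono1) simp
  moreover have "5 * l div 2 = 2 * l + l div 2" for l :: int by presburger
  ultimately show ?thesis by (simp add: hole_def)
qed

lemma funpow_hole_gap: "i \<le> j \<Longrightarrow> (hole ^^ k) i + 2 ^ k * (j - i) \<le> (hole ^^ k) j"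
proof (induction k)
  case (Suc k)
  have "(hole ^^ k) i \<le> (hole ^^ k) j"
    using Suc by (smt (verit) zero_le_mult_iff zero_le_power)
  from hole_gap[OF this] Suc show ?case
    by (simp add: mult.assoc)
qed simp

lemma funpow_hole_close:
  assumes "\<bar>(hole ^^ k) i - (hole ^^ k) j\<bar> < 2 ^ k"
  shows "i = j"
proof -
  have "\<not> i < j" if "\<bar>(hole ^^ k) i - (hole ^^ k) j\<bar> < 2 ^ k" for i j
  proof
    assume "i < j"
    then have "2 ^ k * 1 \<le> (2::int) ^ k * (j - i)" by (intro mult_left_mono) auto
    moreover have "(hole ^^ k) i + 2 ^ k * (j - i) \<le> (hole ^^ k) j"
      using \<open>i < j\<close> by (intro funpow_hole_gap) simp
    ultimately show False using that by linarith
  qed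
  from this[of i j] this[of j i] assms show ?thesis by (auto simp: abs_minus_commute)
qed

text \<open>Off the holes of level \<open>k\<close> the letter was written by the pattern at an
  earlier level, whose period divides \<open>5 ^ k\<close>. Two sequences \<open>y\<close> and
  \<open>z\<close> express periodicity and independence of the contents at once.\<close>

lemma funpow_fill_off_holes:
  assumes "n \<notin> range (hole ^^ k)"
  shows "(fill ^^ k) y (n + 5 ^ k * m) = (fill ^^ k) z n"
  using assms
proof (induction k arbitrary: n m)
  case (Suc k)
  show ?case
  proof (cases "n mod 5 = 1 \<or> n mod 5 = 3")
    case True
    let ?i = "2 * n div 5"
    have "?i \<notin> range (hole ^^ k)"
    proof
      assume "?i \<in> range (hole ^^ k)"
      then obtain e where "?i = (hole ^^ k) e" by auto
      then have "n = (hole ^^ Suc k) e" using hole_of_div[OF True] by simp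
      with Suc.prems show False by auto
    qed
    from Suc.IH[OF this, of "2 * m"]
    have "(fill ^^ k) y (?i + 2 * (5 ^ k * m)) = (fill ^^ k) z ?i" by (simp add: mult_ac)
    moreover have "fill w (n + 5 * M) = w (?i + 2 * M)" for w M
    proof -
      have "2 * (n + 5 * M) div 5 = ?i + 2 * M" by (rule double_div_add)
      then show ?thesis using True by (simp add: fill_def)
    qed
    moreover have "fill w n = w ?i" for w using True by (simp add: fill_def)
    ultimately show ?thesis by (simp add: mult.assoc)
  next
    case False
    then have "fill w (n + 5 * M) = nat (n mod 5)" "fill w n = nat (n mod 5)" for w M
      by (simp_all add: fill_def)
    then show ?thesis by (simp add: mult.assoc)
  qed
qed auto

text \<open>The recursion stops at a pattern letter, which has period 5, and each passage through a
  hole multiplies the period by 5.\<close>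

lemma base_point_periodic: "\<exists>k. \<forall>m. base_point (n + 5 ^ k * m) = base_point n"
proof (induction n rule: base_point.induct)
  case (1 n)
  show ?case
  proof (cases "n mod 5 = 1 \<or> n mod 5 = 3")
    case True
    with 1 obtain k where k: "\<And>m. base_point (2 * n div 5 + 5 ^ k * m) = base_point (2 * n div 5)"
      by blast
    have "base_point (n + 5 ^ Suc k * m) = base_point n" for m
    proof -
      let ?M = "5 ^ k * m"
      have "2 * (n + 5 * ?M) div 5 = 2 * n div 5 + 2 * ?M" by (rule double_div_add)
      then have "base_point (n + 5 * ?M) = base_point (2 * n div 5 + 2 * ?M)"
        using True by (simp add: base_point.simps[of "n + 5 * ?M"])
      also have "\<dots> = base_point (2 * n div 5)" using k[of "2 * m"] by (simp add: mult_ac)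
      also have "\<dots> = base_point n" using True by (simp add: base_point.simps[of n])
      finally show ?thesis by (simp add: mult.assoc)
    qed
    then show ?thesis by blast
  next
    case False
    then show ?thesis
      by (intro exI[of _ 1]) (simp add: base_point.simps[of n] base_point.simps[of "n + 5 * _"])
  qed
qed

lemma base_point_periodic_window:
  assumes "finite W"
  shows "\<exists>k. \<forall>n\<in>W. \<forall>m. base_point (n + 5 ^ k * m) = base_point n"
  using assms
proof induction
  case (insert a W)
  then obtain k where k: "\<forall>n\<in>W. \<forall>m. base_point (n + 5 ^ k * m) = base_point n" by blast
  obtain l where l: "\<forall>m. base_point (a + 5 ^ l * m) = base_point a"
    using base_point_periodic by blast
  have "base_point (n + 5 ^ (k + l) * m) = base_point n" if "n \<in> insert a W" for n m
  proof (cases "n = a")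
    case True
    then show ?thesis using l[rule_format, of "5 ^ k * m"] by (simp add: power_add mult_ac)
  next
    case False
    then show ?thesis using k[rule_format, of n "5 ^ l * m"] that by (simp add: power_add mult_ac)
  qed
  then show ?case by blast
qed auto

subsection \<open>The orbit closure of the base point\<close>

text \<open>The orbit closure in terms of windows, without topology; \<open>toep_eq_closure\<close>
  justifies this form.\<close>

definition toep_closure :: "(int \<Rightarrow> nat) set" where
  "toep_closure = {u. \<forall>N. \<exists>m. \<forall>i. \<bar>i\<bar> \<le> N \<longrightarrow> u i = base_point (i + m)}"

lemma base_point_in_toep: "base_point \<in> toep_closure"
  unfolding toep_closure_def by (auto intro: exI[of _ 0])

lemma shift_iter_add: "shift_iter a (shift_iter b u) = shift_iter (a + b) u"
  by (simp add: shift_iter_def fun_eq_iff add_ac)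

lemma shift_iter_0 [simp]: "shift_iter 0 u = u"
  by (simp add: shift_iter_def)

lemma shift_iter_in_toep:
  assumes "u \<in> toep_closure"
  shows "shift_iter a u \<in> toep_closure"
  unfolding toep_closure_def
proof (intro CollectI allI)
  fix N
  obtain m where "\<And>i. \<bar>i\<bar> \<le> N + \<bar>a\<bar> \<Longrightarrow> u i = base_point (i + m)"
    using assms unfolding toep_closure_def by blast
  then have "\<forall>i. \<bar>i\<bar> \<le> N \<longrightarrow> shift_iter a u i = base_point (i + (a + m))"
    by (simp add: shift_iter_def add.assoc)
  then show "\<exists>m. \<forall>i. \<bar>i\<bar> \<le> N \<longrightarrow> shift_iter a u i = base_point (i + m)" by blast
qed

text \<open>A finite window of the base point recurs with some period \<open>5 ^ k\<close>. This is
  odd, so an occurrence at an odd place can be moved to an even one, where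
  \<open>fill_shift_iter\<close> applies.\<close>

lemma toep_even_window:
  assumes "u \<in> toep_closure"
  shows "\<exists>m. \<forall>i. \<bar>i\<bar> \<le> N \<longrightarrow> u i = base_point (i + 2 * m)"
proof -
  obtain m where m: "\<And>i. \<bar>i\<bar> \<le> N \<Longrightarrow> u i = base_point (i + m)"
    using assms unfolding toep_closure_def by blast
  obtain k where k: "\<forall>n\<in>{- N + m..N + m}. \<forall>l. base_point (n + 5 ^ k * l) = base_point n"
    using base_point_periodic_window[of "{- N + m..N + m}"] by auto
  have "even (m + 5 ^ k * m)" by simp
  then obtain m' where m': "m + 5 ^ k * m = 2 * m'" by (elim evenE)
  have "u i = base_point (i + 2 * m')" if "\<bar>i\<bar> \<le> N" for i
  proof -
    have "i + m \<in> {- N + m..N + m}" using that by auto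
    with k have "base_point (i + m + 5 ^ k * m) = base_point (i + m)" by blast
    then show ?thesis using m[OF that] m' by (simp add: add.assoc)
  qed
  then show ?thesis by blast
qed

lemma fill_in_toep:
  assumes "u \<in> toep_closure"
  shows "fill u \<in> toep_closure"
  unfolding toep_closure_def
proof (intro CollectI allI)
  fix N
  obtain m where m: "\<And>i. \<bar>i\<bar> \<le> N \<Longrightarrow> u i = base_point (i + 2 * m)"
    using toep_even_window[OF assms] by blast
  have "fill u i = base_point (i + 5 * m)" if "\<bar>i\<bar> \<le> N" for i
  proof -
    have "\<bar>2 * i div 5\<bar> \<le> N" using that by linarith
    then have "fill u i = fill (shift_iter (2 * m) base_point) i"
      using m by (simp add: fill_def shift_iter_def)
    also have "\<dots> = shift_iter (5 * m) base_point i"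
      by (simp add: fill_shift_iter fill_base_point)
    finally show ?thesis by (simp add: shift_iter_def)
  qed
  then show "\<exists>m. \<forall>i. \<bar>i\<bar> \<le> N \<longrightarrow> fill u i = base_point (i + m)" by blast
qed

lemma funpow_fill_in_toep: "u \<in> toep_closure \<Longrightarrow> (fill ^^ k) u \<in> toep_closure"
  by (induction k) (simp_all add: fill_in_toep)

text \<open>Pigeonhole on the five residues of the offset: if each residue failed for some window,
  the largest of these windows would have no admissible offset.\<close>

lemma toep_phase:
  assumes "u \<in> toep_closure"
  obtains j where "\<And>N. \<exists>m. \<forall>i. \<bar>i\<bar> \<le> N \<longrightarrow> u i = base_point (i + j + 5 * m)"
proof -
  have "\<exists>j\<in>{0..<5}. \<forall>N. \<exists>m. \<forall>i. \<bar>i\<bar> \<le> N \<longrightarrow> u i = base_point (i + j + 5 * m)"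
  proof (rule ccontr)
    assume "\<not> ?thesis"
    then have "\<forall>j\<in>{0..<5}. \<exists>N. \<not> (\<exists>m. \<forall>i. \<bar>i\<bar> \<le> N \<longrightarrow> u i = base_point (i + j + 5 * m))"
      by blast
    then obtain N where N: "\<forall>j\<in>{0..<5}.
        \<not> (\<exists>m. \<forall>i. \<bar>i\<bar> \<le> N j \<longrightarrow> u i = base_point (i + j + 5 * m))"
      by (rule bchoice[THEN exE]) blast
    define M where "M = Max (N ` {0..<5})"
    obtain m where m: "\<And>i. \<bar>i\<bar> \<le> M \<Longrightarrow> u i = base_point (i + m)"
      using assms unfolding toep_closure_def by blast
    have mod: "m mod 5 \<in> {0..<5}" by simp
    then have "N (m mod 5) \<le> M" unfolding M_def by (intro Max_ge) auto
    then have "\<forall>i. \<bar>i\<bar> \<le> N (m mod 5) \<longrightarrow> u i = base_point (i + m mod 5 + 5 * (m div 5))"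
      using m by (simp add: add.assoc)
    with N mod show False by blast
  qed
  with that show thesis by blast
qed

text \<open>Since one phase \<open>j\<close> serves all windows, the positions of the pattern in
  \<open>u\<close> are known, and \<open>y\<close> is read off the holes.\<close>

lemma toep_decompose:
  assumes "u \<in> toep_closure"
  obtains j y where "y \<in> toep_closure" "u = shift_iter j (fill y)"
proof -
  obtain j where j: "\<And>N. \<exists>m. \<forall>i. \<bar>i\<bar> \<le> N \<longrightarrow> u i = base_point (i + j + 5 * m)"
    using toep_phase[OF assms] by blast
  define y where "y = (\<lambda>i. u (hole i - j))"
  have "y \<in> toep_closure"
    unfolding toep_closure_def
  proof (intro CollectI allI)
    fix N
    \<comment> \<open>This radius contains \<open>hole i - j\<close> for all \<bar>i\<bar> \<le> N,
      as \<open>hole\<close> stretches by the factor 5/2.\<close>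
    obtain m where m: "\<And>i. \<bar>i\<bar> \<le> 3 * \<bar>N\<bar> + 1 + \<bar>j\<bar> \<Longrightarrow> u i = base_point (i + j + 5 * m)"
      using j by blast
    have "y i = base_point (i + 2 * m)" if "\<bar>i\<bar> \<le> N" for i
    proof -
      have "\<bar>hole i\<bar> \<le> 3 * \<bar>N\<bar> + 1" using that unfolding hole_def by linarith
      then have "y i = base_point (hole i + 5 * m)" using m[of "hole i - j"] by (simp add: y_def)
      also have "\<dots> = fill base_point (hole (i + 2 * m))" by (simp add: hole_add fill_base_point)
      finally show ?thesis by simp
    qed
    then show "\<exists>m. \<forall>i. \<bar>i\<bar> \<le> N \<longrightarrow> y i = base_point (i + m)" by blast
  qed
  moreover have "u n = shift_iter j (fill y) n" for n
  proof (cases "(n + j) mod 5 = 1 \<or> (n + j) mod 5 = 3")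
    case True
    then show ?thesis using hole_of_div[OF True] by (simp add: shift_iter_def fill_def y_def)
  next
    case False
    obtain m where "u n = base_point (n + j + 5 * m)" using j[of "\<bar>n\<bar>"] by blast
    with False show ?thesis
      by (simp add: shift_iter_def fill_def base_point.simps[of "n + j + 5 * m"])
  qed
  ultimately show thesis using that by blast
qed

lemma toep_range:
  assumes "u \<in> toep_closure"
  shows "u n \<in> {0, 2, 4}"
proof -
  have "base_point n \<in> {0, 2, 4}" for n
  proof (induction n rule: base_point.induct)
    case (1 n)
    have "nat (n mod 5) \<in> {0, 2, 4}" if "\<not> (n mod 5 = 1 \<or> n mod 5 = 3)"
    proof -
      have "n mod 5 = 0 \<or> n mod 5 = 2 \<or> n mod 5 = 4" using that by linarith
      then show ?thesis by auto
    qed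
    with 1 show ?case by (subst base_point.simps) (simp del: insert_iff)
  qed
  moreover obtain m where "u n = base_point (n + m)"
    using assms unfolding toep_closure_def by (auto dest: spec[of _ "\<bar>n\<bar>"])
  ultimately show ?thesis by simp
qed

section \<open>Arithmetic progressions whose step is a power of two\<close>

lemma progression_hits_residue: "\<exists>m. (n + 2 ^ e * m) mod 5 = r mod (5::int)"
proof -
  have "coprime (2 ^ e) (5::int)" by simp
  then obtain a b where ab: "a * 2 ^ e + b * 5 = (1::int)"
    using bezout_int[of "2 ^ e" 5] by auto
  have "n + 2 ^ e * (a * (r - n)) = n + (a * 2 ^ e) * (r - n)" by (simp add: mult_ac)
  also have "a * 2 ^ e = 1 - b * 5" using ab by simp
  also have "n + (1 - b * 5) * (r - n) = r + 5 * (b * (n - r))" by (simp add: algebra_simps)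
  finally show ?thesis by (intro exI[of _ "a * (r - n)"]) simp
qed

text \<open>As \<open>2 ^ e\<close> is invertible modulo 5, the progression meets the residues 0 and
  2 of the outermost pattern, which carry different letters.\<close>

lemma toep_not_constant:
  assumes "y \<in> toep_closure"
  shows "\<exists>m. y (n + 2 ^ e * m) \<noteq> a"
proof -
  obtain j z where y: "y = shift_iter j (fill z)" using toep_decompose[OF assms] by blast
  obtain m where m: "(n + j + 2 ^ e * m) mod 5 = 0"
    using progression_hits_residue[of "n + j" e 0] by (metis mod_0)
  obtain l where l: "(n + j + 2 ^ e * l) mod 5 = 2"
    using progression_hits_residue[of "n + j" e 2] by fastforce
  have "y (n + 2 ^ e * m) = 0" "y (n + 2 ^ e * l) = 2"
    using m l by (simp_all add: y shift_iter_def fill_def add_ac)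
  then show ?thesis by (metis zero_neq_numeral)
qed

lemma funpow_toep_decompose:
  assumes "u \<in> toep_closure"
  obtains j y where "y \<in> toep_closure" "u = shift_iter j ((fill ^^ k) y)"
proof -
  have "\<exists>j y. y \<in> toep_closure \<and> u = shift_iter j ((fill ^^ k) y)"
    using assms
  proof (induction k arbitrary: u)
    case 0
    then show ?case by (auto intro: exI[of _ 0])
  next
    case (Suc k)
    obtain j v where v: "v \<in> toep_closure" "u = shift_iter j (fill v)"
      using toep_decompose[OF Suc.prems] by blast
    obtain i y where y: "y \<in> toep_closure" "v = shift_iter i ((fill ^^ k) y)"
      using Suc.IH[OF v(1)] by blast
    \<comment> \<open>Only an even shift passes through \<open>fill\<close>. The phase
      \<open>i\<close> is made even by adding \<open>5 ^ k * i\<close>, which shifting the contents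
      by \<open>- (2 ^ k * i)\<close> compensates.\<close>
    have "even (i + 5 ^ k * i)" by simp
    then obtain l where l: "i + 5 ^ k * i = 2 * l" by (elim evenE)
    define z where "z = shift_iter (2 ^ k * - i) y"
    have "y = shift_iter (2 ^ k * i) z" by (simp add: z_def shift_iter_add)
    then have "v = shift_iter (2 * l) ((fill ^^ k) z)"
      by (simp add: y(2) funpow_fill_shift_iter shift_iter_add l)
    then have "u = shift_iter (j + 5 * l) ((fill ^^ Suc k) z)"
      by (simp add: v(2) fill_shift_iter shift_iter_add)
    moreover have "z \<in> toep_closure" using y(1) by (simp add: z_def shift_iter_in_toep)
    ultimately show ?case by blast
  qed
  with that show thesis by blast
qed

section \<open>Uniqueness of contents and phase, and aperiodicity\<close>

lemma fill_inj: "fill y = fill z \<Longrightarrow> y = z"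
  by (metis fill_hole ext)

lemma funpow_fill_inj: "(fill ^^ k) y = (fill ^^ k) z \<Longrightarrow> y = z"
  by (metis funpow_fill_hole ext)

text \<open>The letters 0 of \<open>fill z\<close> at multiples of 5 must appear in
  \<open>fill y\<close> along the class of \<open>j\<close>. Residues 2 and 4 carry other letters,
  and residues 1 and 3 would make every second entry of \<open>y\<close> zero.\<close>

lemma fill_phase_unique:
  assumes "y \<in> toep_closure" and eq: "shift_iter j (fill y) = fill z"
  shows "5 dvd j"
proof (rule ccontr)
  assume j: "\<not> 5 dvd j"
  have E: "fill y (5 * q + j) = 0" for q
    using fun_cong[OF eq, of "5 * q"] by (simp add: shift_iter_def fill_def)
  define p where "p = j div 5"
  have jp: "j = 5 * p + j mod 5" by (simp add: p_def)
  have contents: "y (i + 2 * q) = 0" if "j mod 5 = hole i" for i q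
  proof -
    have "hole (i + 2 * q) = 5 * (q - p) + j" using jp that by (simp add: hole_add)
    then show ?thesis using E[of "q - p"] fill_hole[of y "i + 2 * q"] by simp
  qed
  have "j mod 5 = 1 \<or> j mod 5 = 3 \<or> j mod 5 = 2 \<or> j mod 5 = 4" using j by presburger
  then show False
  proof (elim disjE)
    assume "j mod 5 = 1"
    with contents[of 0] toep_not_constant[OF assms(1), of 0 1 0] show False
      by (simp add: hole_def)
  next
    assume "j mod 5 = 3"
    with contents[of 1] toep_not_constant[OF assms(1), of 1 1 0] show False
      by (simp add: hole_def)
  qed (use E[of 0] in \<open>simp_all add: fill_def\<close>)
qed

text \<open>Peeling off the outermost level turns a phase \<open>5 * i\<close> into
  \<open>2 * i\<close> one level down; the factor 2 is harmless because it is coprime to 5.\<close>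

lemma funpow_fill_phase_unique:
  assumes "y \<in> toep_closure" "shift_iter j ((fill ^^ k) y) = (fill ^^ k) z"
  shows "5 ^ k dvd j"
  using assms(2)
proof (induction k arbitrary: j)
  case (Suc k)
  have "5 dvd j"
    using fill_phase_unique[of "(fill ^^ k) y" j "(fill ^^ k) z"] Suc.prems assms(1)
    by (simp add: funpow_fill_in_toep)
  then obtain i where i: "j = 5 * i" by auto
  have "fill (shift_iter (2 * i) ((fill ^^ k) y)) = fill ((fill ^^ k) z)"
    using Suc.prems by (simp add: i fill_shift_iter)
  then have "5 ^ k dvd 2 * i" by (rule Suc.IH[OF fill_inj])
  moreover have "coprime (5 ^ k) (2::int)" by simp
  ultimately have "5 ^ k dvd i" by (simp add: coprime_dvd_mult_right_iff)
  then show ?case by (simp add: i)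
qed simp

text \<open>Every \<open>fill ^^ k\<close> fixes the base point, so a period is divisible by every
  \<open>5 ^ k\<close>; the choice k = \<bar>m\<bar> is already too large for a nonzero
  \<open>m\<close>.\<close>

lemma base_point_aperiodic:
  assumes "shift_iter m base_point = base_point"
  shows "m = 0"
proof (rule ccontr)
  assume "m \<noteq> 0"
  have "5 ^ nat \<bar>m\<bar> dvd m"
    using funpow_fill_phase_unique[OF base_point_in_toep, of m _ base_point] assms
    by (simp add: funpow_fill_base_point)
  then have "5 ^ nat \<bar>m\<bar> \<le> \<bar>m\<bar>" using \<open>m \<noteq> 0\<close> by (simp add: zdvd_imp_le)
  moreover have "int (nat \<bar>m\<bar>) < int (5 ^ nat \<bar>m\<bar>)"
    by (subst of_nat_less_iff) (rule power_gt_expt, simp)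
  ultimately show False by simp
qed

text \<open>By hypothesis \<open>y i\<close> is a function of \<open>i mod 2 ^ k\<close> and
  \<open>z i\<close>. First the outermost patterns of \<open>y\<close> and \<open>z\<close> are
  shown to be aligned; then each letter is compared at a pattern position in the same class modulo
  \<open>2 ^ k\<close>.\<close>

lemma toep_rigid:
  assumes y: "y \<in> toep_closure" and z: "z \<in> toep_closure"
    and dep: "\<And>i m. z i = z (i + 2 ^ k * m) \<Longrightarrow> y i = y (i + 2 ^ k * m)"
  shows "y = z"
proof -
  obtain a y' where y': "y' \<in> toep_closure" "y = shift_iter a (fill y')" using toep_decompose[OF y] .
  obtain b z' where z': "z' \<in> toep_closure" "z = shift_iter b (fill z')" using toep_decompose[OF z] .
  \<comment> \<open>At a pattern position of \<open>z\<close> the sequence \<open>z\<close> has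
    period 5, so \<open>y\<close> is constant along \<open>n + 5 * 2 ^ k * m\<close>. If
    \<open>n\<close> were a hole of \<open>y\<close>, then \<open>y'\<close> would be constant along
    a progression with step \<open>2 ^ Suc k\<close>.\<close>
  have off: "(n + a) mod 5 \<noteq> 1 \<and> (n + a) mod 5 \<noteq> 3"
    if n: "(n + b) mod 5 \<noteq> 1" "(n + b) mod 5 \<noteq> 3" for n
  proof (rule ccontr)
    assume h: "\<not> ?thesis"
    let ?i = "2 * (n + a) div 5"
    have "y' (?i + 2 ^ Suc k * m) = y n" for m
    proof -
      let ?M = "2 ^ k * m"
      have "z n = z (n + 2 ^ k * (5 * m))"
      proof -
        have "(n + 5 * ?M + b) mod 5 = (n + b) mod 5"
          by (metis add.assoc add.commute mod_mult_self2)
        then show ?thesis using n by (simp add: z'(2) shift_iter_def fill_def mult_ac)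
      qed
      then have "y n = y (n + 5 * ?M)"
        using dep[of n "5 * m"] by (simp only: mult.left_commute)
      moreover have "(n + 5 * ?M + a) mod 5 = (n + a) mod 5"
        by (metis add.assoc add.commute mod_mult_self2)
      moreover have "2 * (n + 5 * ?M + a) div 5 = ?i + 2 * ?M"
        using double_div_add[of "n + a" ?M] by (simp add: add_ac)
      ultimately show ?thesis using h by (auto simp: y'(2) shift_iter_def fill_def mult_ac)
    qed
    then show False using toep_not_constant[OF y'(1)] by blast
  qed
  \<comment> \<open>Translation by \<open>a - b\<close> keeps the residues 0, 2, 4 away from 1 and
    3, which only the trivial translation modulo 5 does.\<close>
  have ab: "a mod 5 = b mod 5"
  proof -
    have "d mod 5 = 0" if "d mod 5 \<noteq> 1" "d mod 5 \<noteq> 3" "(2 + d) mod 5 \<noteq> 1" "(4 + d) mod 5 \<noteq> 1"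
      for d :: int
      using that by presburger
    from this[of "a - b"] have "(a - b) mod 5 = 0"
      using off[of "- b"] off[of "2 - b"] off[of "4 - b"] by (simp add: algebra_simps)
    then show ?thesis by (simp add: mod_eq_dvd_iff mod_eq_0_iff_dvd)
  qed
  show ?thesis
  proof
    fix n
    have l: "z n \<in> {0, 2, 4}" by (rule toep_range[OF z])
    \<comment> \<open>The letter \<open>z n\<close> is itself a pattern residue, and the pattern
      writes each such residue as its own letter; so at \<open>n + 2 ^ k * m\<close> both sequences
      show \<open>z n\<close>.\<close>
    obtain m where "(n + b + 2 ^ k * m) mod 5 = int (z n) mod 5"
      using progression_hits_residue by blast
    then have m: "(n + 2 ^ k * m + b) mod 5 = int (z n)"
      using l by (auto simp: add_ac)
    moreover have "(n + 2 ^ k * m + a) mod 5 = (n + 2 ^ k * m + b) mod 5"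
      using ab by (metis mod_add_right_eq)
    moreover have "shift_iter c (fill v) n' = z n" if "(n' + c) mod 5 = int (z n)" for c v n'
      using that l by (auto simp: shift_iter_def fill_def)
    ultimately have "y (n + 2 ^ k * m) = z n" "z (n + 2 ^ k * m) = z n"
      by (simp_all only: y'(2) z'(2))
    with dep[of n m] show "y n = z n" by metis
  qed
qed

text \<open>Each level-\<open>k\<close> hole of \<open>w\<close> is matched with the one
  level-\<open>k\<close> hole of the base point within distance \<open>r\<close>. The matching
  \<open>c\<close> proves to be a translation, and \<open>toep_rigid\<close> then identifies
  \<open>y\<close>.\<close>

lemma local_image_contents:
  assumes w: "shift_iter t ((fill ^^ k) y) = w" and y: "y \<in> toep_closure"
    and rule: "\<And>n n'. (\<And>s. \<bar>s\<bar> \<le> r \<Longrightarrow> base_point (n + s) = base_point (n' + s)) \<Longrightarrow> w n = w n'"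
    and r: "2 * r < 2 ^ k"
  shows "\<exists>c. y = shift_iter c base_point"
proof -
  define P where "P = hole ^^ k"
  have P_add: "P (i + 2 ^ k * m) = P i + 5 ^ k * m" for i m
    by (simp add: P_def funpow_hole_add)
  have P_close: "i = j" if "\<bar>P i - P j\<bar> < 2 ^ k" for i j
    using that funpow_hole_close by (simp add: P_def)
  have yw: "y i = w (P i - t)" for i
    unfolding w[symmetric] P_def shift_iter_def by (simp add: funpow_fill_hole)
  have on: "base_point (P i) = base_point i" for i
    using funpow_fill_hole[of k base_point i] by (simp add: P_def funpow_fill_base_point)
  have off: "base_point (n + 5 ^ k * m) = base_point n" if "n \<notin> range P" for n m
    using funpow_fill_off_holes[of n k base_point m base_point] that
    by (simp add: P_def funpow_fill_base_point)
  \<comment> \<open>Without a hole nearby, the window around \<open>P i - t\<close> has period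
    \<open>5 ^ k\<close>, and \<open>y\<close> would be constant along a progression with step
    \<open>2 ^ k\<close>.\<close>
  have "\<exists>c. \<bar>P c - (P i - t)\<bar> \<le> r" for i
  proof (rule ccontr)
    assume none: "\<not> ?thesis"
    have "y (i + 2 ^ k * m) = y i" for m
      unfolding yw P_add
    proof (rule rule)
      fix s :: int
      assume s: "\<bar>s\<bar> \<le> r"
      have "P i - t + s \<noteq> P e" for e using none s by (metis add_diff_cancel_left')
      then have "P i - t + s \<notin> range P" by blast
      from off[OF this, of m] show "base_point (P i + 5 ^ k * m - t + s) = base_point (P i - t + s)"
        by (simp add: algebra_simps)
    qed
    then show False using toep_not_constant[OF y] by blast
  qed
  then obtain c where c: "\<And>i. \<bar>P (c i) - (P i - t)\<bar> \<le> r" by metis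
  \<comment> \<open>Two holes within \<open>r\<close> of the same place are at most
    \<open>2 * r\<close> apart, less than the minimal gap \<open>2 ^ k\<close>.\<close>
  have c_unique: "c i = e" if "\<bar>P e - (P i - t)\<bar> \<le> r" for i e
    using c[of i] that r by (intro P_close) linarith
  have c_add: "c (i + 2 ^ k * m) = c i + 2 ^ k * m" for i m
    using c[of i] by (intro c_unique) (simp add: P_add)
  have mono: "c i + 1 \<le> c (i + 1)" for i
  proof (rule ccontr)
    assume "\<not> ?thesis"
    then have le: "c (i + 1) \<le> c i" by simp
    then have "0 \<le> 2 ^ k * (c i - c (i + 1))" by simp
    then have "P (c (i + 1)) \<le> P (c i)"
      using funpow_hole_gap[OF le, of k] unfolding P_def by linarith
    moreover have "P i + 2 ^ k \<le> P (i + 1)"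
      using funpow_hole_gap[of i "i + 1" k] by (simp add: P_def)
    ultimately show False using c[of i] c[of "i + 1"] r by linarith
  qed
  have mono': "c i - i \<le> c j - j" if "i \<le> j" for i j
    using that
  proof (induction rule: int_ge_induct)
    case (step l)
    then show ?case using mono[of l] by simp
  qed simp
  \<comment> \<open>The difference \<open>c i - i\<close> is nondecreasing and equals
    \<open>c 0\<close> at every multiple of \<open>2 ^ k\<close>, so it is squeezed between 0 and
    \<open>2 ^ k * i\<close>.\<close>
  have c_eq: "c i = i + c 0" for i
  proof -
    have p: "c (2 ^ k * i) - 2 ^ k * i = c 0" using c_add[of 0 i] by simp
    show ?thesis
    proof (cases "0 \<le> i")
      case True
      then have "i \<le> 2 ^ k * i" using mult_right_mono[of 1 "2 ^ k" i] by simp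
      from mono'[OF True] mono'[OF this] p show ?thesis by linarith
    next
      case False
      then have neg: "i \<le> 0" by simp
      then have "2 ^ k * i \<le> i" using mult_right_mono_neg[of 1 "2 ^ k" i] by simp
      from mono'[OF neg] mono'[OF this] p show ?thesis by linarith
    qed
  qed
  have "y = shift_iter (c 0) base_point"
  proof (rule toep_rigid[OF y shift_iter_in_toep[OF base_point_in_toep]])
    fix i m
    assume eq: "shift_iter (c 0) base_point i = shift_iter (c 0) base_point (i + 2 ^ k * m)"
    show "y i = y (i + 2 ^ k * m)"
      unfolding yw P_add
    proof (rule rule)
      fix s :: int
      assume s: "\<bar>s\<bar> \<le> r"
      \<comment> \<open>The window contains only the hole \<open>P (i + c 0)\<close>, where the two
        letters agree by \<open>eq\<close>; all other positions have period
        \<open>5 ^ k\<close>.\<close>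
      have "base_point (P i - t + s) = base_point (P i - t + s + 5 ^ k * m)"
      proof (cases "P i - t + s \<in> range P")
        case True
        then obtain e where e: "P i - t + s = P e" by blast
        have "\<bar>P e - (P i - t)\<bar> \<le> r" using s e by linarith
        then have "e = i + c 0" using c_unique c_eq by metis
        then have "base_point e = base_point (e + 2 ^ k * m)"
          using eq by (simp add: shift_iter_def add_ac)
        then show ?thesis unfolding e by (simp only: on P_add[symmetric])
      next
        case False
        then show ?thesis by (rule off[symmetric])
      qed
      then show "base_point (P i - t + s) = base_point (P i + 5 ^ k * m - t + s)"
        by (simp add: algebra_simps)
    qed
  qed
  then show ?thesis by blast
qed

subsection \<open>The automorphisms\<close>

abbreviation digits :: "nat set" where
  "digits \<equiv> {..<5}"

lemma toep_range_subset:
  assumes "u \<in> toep_closure"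
  shows "range u \<subseteq> digits"
proof
  fix a
  assume "a \<in> range u"
  then obtain n where "a = u n" by blast
  with toep_range[OF assms, of n] show "a \<in> digits" by auto
qed

lemma toep_eq_closure: "toep_closure = full_shift digits closure_of {shift_iter i base_point |i. True}"
  unfolding toep_closure_def by (rule closure_of_orbit[symmetric, OF toep_range_subset[OF base_point_in_toep]])

lemma toeplitz_point_base_point: "toeplitz_point digits base_point"
  unfolding toeplitz_point_def topspace_full_shift
proof (intro conjI allI)
  show "base_point \<in> {x. range x \<subseteq> digits}"
    using toep_range_subset[OF base_point_in_toep] by simp
  fix n
  obtain k where "\<And>m. base_point (n + 5 ^ k * m) = base_point n"
    using base_point_periodic by blast
  then show "\<exists>p>0. \<forall>m. base_point (n + m * p) = base_point n"
    by (intro exI[of _ "5 ^ k"]) (simp add: mult.commute)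
qed

lemma toeplitz_subshift_toep: "toeplitz_subshift digits toep_closure"
  unfolding toeplitz_subshift_def using toeplitz_point_base_point toep_eq_closure by blast

lemma closedin_toep: "closedin (full_shift digits) toep_closure"
  by (simp add: toep_eq_closure)

lemma compactin_toep: "compactin (full_shift digits) toep_closure"
  by (rule closedin_compact_space[OF compact_space_full_shift closedin_toep]) simp

abbreviation toep_top :: "(int \<Rightarrow> nat) topology" where
  "toep_top \<equiv> subtopology (full_shift digits) toep_closure"

lemma topspace_toep: "topspace toep_top = toep_closure"
  using closedin_subset[OF closedin_toep] by auto

lemma compact_space_toep: "compact_space toep_top"
  using compactin_toep by (simp add: compact_space_subtopology)

lemma Hausdorff_space_toep: "Hausdorff_space toep_top"
  by (simp add: Hausdorff_space_full_shift Hausdorff_space_subtopology)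

lemma continuous_map_coordinate: "continuous_map (full_shift S) (discrete_topology S) (\<lambda>u. u i)"
  unfolding full_shift_def by (intro continuous_map_product_projection) simp

lemma continuous_map_fill: "continuous_map (full_shift digits) (full_shift digits) fill"
proof -
  have "continuous_map (full_shift digits) (discrete_topology digits) (\<lambda>u. fill u i)" for i
  proof (cases "i mod 5 = 1 \<or> i mod 5 = 3")
    case True
    then show ?thesis using continuous_map_coordinate by (simp add: fill_def)
  next
    case False
    have "nat (i mod 5) < 5" by (simp add: nat_less_iff)
    with False show ?thesis by (simp add: fill_def)
  qed
  then show ?thesis
    unfolding full_shift_def by (simp add: continuous_map_componentwise_UNIV)
qed

lemma continuous_map_into_toep:
  assumes "continuous_map (full_shift digits) (full_shift digits) f" "\<And>u. u \<in> toep_closure \<Longrightarrow> f u \<in> toep_closure"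
  shows "continuous_map toep_top toep_top f"
  using assms topspace_toep
  by (auto simp: continuous_map_in_subtopology continuous_map_from_subtopology)

section \<open>Roots of powers of the shift: translating the contents of the level-\<open>k\<close>
  holes\<close>

definition root_shift :: "nat \<Rightarrow> int \<Rightarrow> (int \<Rightarrow> nat) \<Rightarrow> (int \<Rightarrow> nat)" where
  "root_shift k c = (\<lambda>u\<in>toep_closure. THE v. \<exists>j y. y \<in> toep_closure \<and>
     u = shift_iter j ((fill ^^ k) y) \<and> v = shift_iter j ((fill ^^ k) (shift_iter c y)))"

text \<open>Well-definedness: two decompositions of a point differ by a phase
  \<open>5 ^ k * m\<close> and a shift of the contents by \<open>2 ^ k * m\<close>, which commutes
  with the shift by \<open>c\<close>.\<close>

lemma root_shift_eq:
  assumes y: "y \<in> toep_closure"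
  shows "root_shift k c (shift_iter j ((fill ^^ k) y)) = shift_iter j ((fill ^^ k) (shift_iter c y))"
proof -
  let ?u = "shift_iter j ((fill ^^ k) y)"
  have unique: "shift_iter i ((fill ^^ k) (shift_iter c z)) = shift_iter j ((fill ^^ k) (shift_iter c y))"
    if z: "z \<in> toep_closure" "?u = shift_iter i ((fill ^^ k) z)" for i z
  proof -
    have "shift_iter (- i) ?u = (fill ^^ k) z" by (simp add: z(2) shift_iter_add)
    then have eq: "shift_iter (j - i) ((fill ^^ k) y) = (fill ^^ k) z" by (simp add: shift_iter_add)
    then have "5 ^ k dvd j - i" by (rule funpow_fill_phase_unique[OF y])
    then obtain m where m: "j - i = 5 ^ k * m" by blast
    then have "(fill ^^ k) (shift_iter (2 ^ k * m) y) = (fill ^^ k) z"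
      using eq by (simp add: funpow_fill_shift_iter)
    then have "z = shift_iter (2 ^ k * m) y" by (metis funpow_fill_inj)
    then have "shift_iter c z = shift_iter (2 ^ k * m) (shift_iter c y)"
      by (simp add: shift_iter_add add.commute)
    then have "(fill ^^ k) (shift_iter c z) = shift_iter (5 ^ k * m) ((fill ^^ k) (shift_iter c y))"
      by (simp only: funpow_fill_shift_iter)
    moreover have "j = i + 5 ^ k * m" using m by simp
    ultimately show ?thesis by (simp add: shift_iter_add)
  qed
  have "?u \<in> toep_closure" using y by (simp add: shift_iter_in_toep funpow_fill_in_toep)
  then show ?thesis
    unfolding root_shift_def restrict_apply'[OF \<open>?u \<in> toep_closure\<close>]
  proof (intro the_equality)
    show "\<exists>i z. z \<in> toep_closure \<and> ?u = shift_iter i ((fill ^^ k) z) \<and>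
        shift_iter j ((fill ^^ k) (shift_iter c y)) = shift_iter i ((fill ^^ k) (shift_iter c z))"
      using y by blast
    fix v
    assume "\<exists>i z. z \<in> toep_closure \<and> ?u = shift_iter i ((fill ^^ k) z) \<and>
        v = shift_iter i ((fill ^^ k) (shift_iter c z))"
    then obtain i z where "z \<in> toep_closure" "?u = shift_iter i ((fill ^^ k) z)"
      "v = shift_iter i ((fill ^^ k) (shift_iter c z))" by (elim exE conjE)
    then show "v = shift_iter j ((fill ^^ k) (shift_iter c y))" using unique by simp
  qed
qed

lemma root_shift_in_toep: "u \<in> toep_closure \<Longrightarrow> root_shift k c u \<in> toep_closure"
  by (metis funpow_toep_decompose root_shift_eq shift_iter_in_toep funpow_fill_in_toep)

lemma root_shift_extensional: "root_shift k c \<in> extensional toep_closure"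
  by (simp add: root_shift_def)

lemma root_shift_add:
  assumes "u \<in> toep_closure"
  shows "root_shift k (c + d) u = root_shift k c (root_shift k d u)"
proof -
  obtain j y where "y \<in> toep_closure" "u = shift_iter j ((fill ^^ k) y)"
    using funpow_toep_decompose[OF assms] .
  then show ?thesis by (simp add: root_shift_eq shift_iter_in_toep shift_iter_add add.commute)
qed

lemma root_shift_0: "u \<in> toep_closure \<Longrightarrow> root_shift k 0 u = u"
  by (metis funpow_toep_decompose root_shift_eq shift_iter_0)

lemma root_shift_shift_iter:
  assumes "u \<in> toep_closure"
  shows "root_shift k c (shift_iter i u) = shift_iter i (root_shift k c u)"
proof -
  obtain j y where "y \<in> toep_closure" "u = shift_iter j ((fill ^^ k) y)"
    using funpow_toep_decompose[OF assms] .
  then show ?thesis by (simp add: root_shift_eq shift_iter_add)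
qed

lemma root_shift_level_0: "u \<in> toep_closure \<Longrightarrow> root_shift 0 c u = shift_iter c u"
  using root_shift_eq[of u 0 c 0] by simp

lemma root_shift_root: "u \<in> toep_closure \<Longrightarrow> root_shift k (2 ^ k) u = shift_iter (5 ^ k) u"
proof -
  assume "u \<in> toep_closure"
  then obtain j y where "y \<in> toep_closure" "u = shift_iter j ((fill ^^ k) y)"
    by (rule funpow_toep_decompose)
  then show ?thesis
    using funpow_fill_shift_iter[of k 1 y] by (simp add: root_shift_eq shift_iter_add add.commute)
qed

text \<open>The points of phase \<open>j\<close> form a closed set \<open>T j\<close>, on which the
  contents are read by the coordinate map \<open>P j\<close>. Finitely many phases cover the space,
  so the continuous pieces can be pasted.\<close>

lemma continuous_map_root_shift: "continuous_map toep_top toep_top (root_shift k c)"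
proof -
  have cont_fill: "continuous_map toep_top toep_top (fill ^^ k)"
  proof (induction k)
    case (Suc k)
    then show ?case
      using continuous_map_compose[OF Suc continuous_map_into_toep[OF continuous_map_fill fill_in_toep]]
      by (simp add: comp_def)
  qed simp
  have cont_shift: "continuous_map toep_top toep_top (shift_iter i)" for i
    by (rule continuous_map_into_toep[OF continuous_map_shift_iter shift_iter_in_toep])
  define T where "T j = (shift_iter j \<circ> (fill ^^ k)) ` toep_closure" for j
  define P where "P j u = (\<lambda>i. u ((hole ^^ k) i - j))" for j and u :: "int \<Rightarrow> nat"
  have T_sub: "T j \<subseteq> toep_closure" for j
    unfolding T_def by (auto simp: shift_iter_in_toep funpow_fill_in_toep)
  \<comment> \<open>A continuous image of a compact space in a Hausdorff space is closed.\<close>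
  have closed: "closedin toep_top (T j)" for j
    unfolding T_def
    by (intro compactin_imp_closedin Hausdorff_space_toep image_compactin[of toep_top]
        continuous_map_compose[OF cont_fill cont_shift])
      (use compact_space_toep topspace_toep in \<open>simp add: compact_space_def\<close>)
  have P_eq: "P j (shift_iter j ((fill ^^ k) y)) = y" for j y
    by (simp add: P_def shift_iter_def funpow_fill_hole)
  have P_full: "continuous_map (full_shift digits) (full_shift digits) (P j)" for j
    using continuous_map_coordinate[of digits] unfolding full_shift_def P_def
    by (simp only: continuous_map_componentwise_UNIV) simp
  have P_cont: "continuous_map (subtopology toep_top (T j)) toep_top (P j)" for j
    using P_full[of j] topspace_toep T_sub[of j]
    by (auto simp: continuous_map_in_subtopology continuous_map_from_subtopology T_def P_eq)
  show ?thesis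
  proof (rule pasting_lemma_closed[of "{0..<5 ^ k}" _ T _ "\<lambda>j. shift_iter j \<circ> (fill ^^ k) \<circ> shift_iter c \<circ> P j"])
    show "continuous_map (subtopology toep_top (T j)) toep_top
        (shift_iter j \<circ> (fill ^^ k) \<circ> shift_iter c \<circ> P j)" for j
      by (intro continuous_map_compose[OF P_cont] continuous_map_compose[OF cont_shift]
          continuous_map_compose[OF cont_fill] cont_shift)
    have val: "(shift_iter j \<circ> (fill ^^ k) \<circ> shift_iter c \<circ> P j) u = root_shift k c u"
      if "u \<in> T j" for j u
      using that by (auto simp: T_def P_eq root_shift_eq)
    show "(shift_iter i \<circ> (fill ^^ k) \<circ> shift_iter c \<circ> P i) u =
        (shift_iter j \<circ> (fill ^^ k) \<circ> shift_iter c \<circ> P j) u"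
      if "u \<in> topspace toep_top \<inter> T i \<inter> T j" for i j u
      using that val[of u i] val[of u j] by simp
    show "\<exists>j. j \<in> {0..<5 ^ k} \<and> u \<in> T j \<and>
        root_shift k c u = (shift_iter j \<circ> (fill ^^ k) \<circ> shift_iter c \<circ> P j) u"
      if u: "u \<in> topspace toep_top" for u
    proof -
      obtain j y where y: "y \<in> toep_closure" "u = shift_iter j ((fill ^^ k) y)"
        using funpow_toep_decompose u unfolding topspace_toep by blast
      \<comment> \<open>Multiples of \<open>5 ^ k\<close> in the phase are absorbed into the
        contents, leaving a phase below \<open>5 ^ k\<close>.\<close>
      let ?y = "shift_iter (2 ^ k * (j div 5 ^ k)) y"
      have "u = shift_iter (j mod 5 ^ k) ((fill ^^ k) ?y)"
        by (simp add: y(2) funpow_fill_shift_iter shift_iter_add)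
      moreover have "?y \<in> toep_closure" using y by (simp add: shift_iter_in_toep)
      ultimately have "u \<in> T (j mod 5 ^ k)" by (auto simp: T_def)
      then show ?thesis using val[of u "j mod 5 ^ k"] by (intro exI[of _ "j mod 5 ^ k"]) simp
    qed
  qed (use closed in auto)
qed

lemma root_shift_automorphism: "shift_automorphism digits toep_closure (root_shift k c)"
proof -
  have "homeomorphic_maps toep_top toep_top (root_shift k c) (root_shift k (- c))"
    unfolding homeomorphic_maps_def topspace_toep
    by (simp add: continuous_map_root_shift root_shift_add[symmetric] root_shift_0)
  moreover have "shift u = shift_iter 1 u" for u :: "int \<Rightarrow> nat"
    by (simp add: shift_def shift_iter_def)
  ultimately show ?thesis
    unfolding shift_automorphism_def shift_endomorphism_def
    by (auto simp: homeomorphic_map_maps continuous_map_root_shift root_shift_shift_iter)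
qed

section \<open>Endomorphisms as local rules\<close>

lemma endomorphism_shift_iter:
  assumes f: "shift_endomorphism digits toep_closure f" and u: "u \<in> toep_closure"
  shows "f (shift_iter c u) = shift_iter c (f u)"
proof -
  have one: "f (shift_iter 1 v) = shift_iter 1 (f v)" if "v \<in> toep_closure" for v
    using f that by (simp add: shift_endomorphism_def shift_def shift_iter_def)
  have nonneg: "f (shift_iter (int n) v) = shift_iter (int n) (f v)" if v: "v \<in> toep_closure" for n v
  proof (induction n)
    case (Suc n)
    have "f (shift_iter (int (Suc n)) v) = f (shift_iter 1 (shift_iter (int n) v))"
      by (simp add: shift_iter_add)
    also have "\<dots> = shift_iter (int (Suc n)) (f v)"
      by (simp only: one[OF shift_iter_in_toep[OF v]] Suc) (simp add: shift_iter_add)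
    finally show ?case .
  qed simp
  show ?thesis
  proof (cases "0 \<le> c")
    case True
    then show ?thesis using nonneg[OF u, of "nat c"] by simp
  next
    case False
    have "f u = shift_iter (- c) (f (shift_iter c u))"
      using nonneg[OF shift_iter_in_toep[OF u], of "nat (- c)" c] False by (simp add: shift_iter_add)
    then show ?thesis by (simp add: shift_iter_add)
  qed
qed

lemma endomorphism_in_toep: "shift_endomorphism digits toep_closure f \<Longrightarrow> u \<in> toep_closure \<Longrightarrow> f u \<in> toep_closure"
  unfolding shift_endomorphism_def
  using continuous_map_image_subset_topspace[of toep_top toep_top f] topspace_toep by auto

text \<open>Commutation with the shift carries the rule for coordinate 0 to all coordinates.\<close>

lemma endomorphism_local_rule:
  assumes f: "shift_endomorphism digits toep_closure f"
  obtains r where "\<forall>u\<in>toep_closure. \<forall>v\<in>toep_closure. \<forall>n m.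
    (\<forall>i. \<bar>i\<bar> \<le> r \<longrightarrow> u (n + i) = v (m + i)) \<longrightarrow> f u n = f v m"
proof -
  have "continuous_map toep_top (full_shift digits) f"
    using f by (simp add: shift_endomorphism_def continuous_map_in_subtopology)
  then obtain r where r: "\<forall>u\<in>toep_closure. \<forall>v\<in>toep_closure. (\<forall>i. \<bar>i\<bar> \<le> r \<longrightarrow> u i = v i) \<longrightarrow> f u 0 = f v 0"
    using continuous_map_local_rule[OF compactin_toep] by blast
  show thesis
  proof (rule that[of r], intro ballI allI impI)
    fix u v n m
    assume u: "u \<in> toep_closure" and v: "v \<in> toep_closure"
      and eq: "\<forall>i. \<bar>i\<bar> \<le> r \<longrightarrow> u (n + i) = v (m + i)"
    have at: "f w l = f (shift_iter l w) 0" if "w \<in> toep_closure" for w l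
      using endomorphism_shift_iter[OF f that, of l] by (simp add: shift_iter_def)
    have "f (shift_iter n u) 0 = f (shift_iter m v) 0"
      using eq by (intro r[rule_format] shift_iter_in_toep u v) (simp add: shift_iter_def add.commute)
    then show "f u n = f v m" using at[OF u] at[OF v] by simp
  qed
qed

text \<open>The orbit of the base point is dense: a window of \<open>u\<close> wide enough for both
  local rules occurs in the base point.\<close>

lemma endomorphism_eqI:
  assumes f: "shift_endomorphism digits toep_closure f" and g: "shift_endomorphism digits toep_closure g"
    and eq: "f base_point = g base_point" and u: "u \<in> toep_closure"
  shows "f u = g u"
proof
  fix n
  obtain r where r: "\<forall>u\<in>toep_closure. \<forall>v\<in>toep_closure. \<forall>n m.
    (\<forall>i. \<bar>i\<bar> \<le> r \<longrightarrow> u (n + i) = v (m + i)) \<longrightarrow> f u n = f v m"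
    using endomorphism_local_rule[OF f] .
  obtain s where s: "\<forall>u\<in>toep_closure. \<forall>v\<in>toep_closure. \<forall>n m.
    (\<forall>i. \<bar>i\<bar> \<le> s \<longrightarrow> u (n + i) = v (m + i)) \<longrightarrow> g u n = g v m"
    using endomorphism_local_rule[OF g] .
  have "shift_iter n u \<in> toep_closure" by (rule shift_iter_in_toep[OF u])
  then obtain m where m: "\<forall>i. \<bar>i\<bar> \<le> max r s \<longrightarrow> shift_iter n u i = base_point (i + m)"
    unfolding toep_closure_def by blast
  then have m: "u (n + i) = base_point (m + i)" if "\<bar>i\<bar> \<le> max r s" for i
    using that by (simp add: shift_iter_def add.commute)
  have "f u n = f base_point m" by (rule r[rule_format, OF u base_point_in_toep]) (simp add: m)
  moreover have "g u n = g base_point m" by (rule s[rule_format, OF u base_point_in_toep]) (simp add: m)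
  ultimately show "f u n = g u n" by (simp add: eq)
qed

text \<open>Beyond the threshold \<open>nat (2 * r)\<close>, the bound \<open>k < 2 ^ k\<close>
  makes the gaps between level-\<open>k\<close> holes exceed \<open>2 * r\<close>, as
  \<open>local_image_contents\<close> demands.\<close>

lemma endomorphism_base_point:
  assumes f: "shift_endomorphism digits toep_closure f"
  shows "\<exists>K. \<forall>k\<ge>K. \<exists>t c. f base_point = shift_iter t (root_shift k c base_point)"
proof -
  obtain r where r: "\<forall>u\<in>toep_closure. \<forall>v\<in>toep_closure. \<forall>n m.
    (\<forall>i. \<bar>i\<bar> \<le> r \<longrightarrow> u (n + i) = v (m + i)) \<longrightarrow> f u n = f v m"
    using endomorphism_local_rule[OF f] .
  have "\<exists>t c. f base_point = shift_iter t (root_shift k c base_point)" if k: "k \<ge> nat (2 * r)" for k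
  proof -
    have fx: "f base_point \<in> toep_closure" by (rule endomorphism_in_toep[OF f base_point_in_toep])
    obtain t y where y: "y \<in> toep_closure" "f base_point = shift_iter t ((fill ^^ k) y)"
      using funpow_toep_decompose[OF fx] .
    have "2 * r \<le> int k" using k by simp
    also have "int k < 2 ^ k" by (rule of_nat_less_two_power)
    finally have "2 * r < 2 ^ k" .
    then obtain c where "y = shift_iter c base_point"
      using local_image_contents[OF y(2)[symmetric] y(1)
          r[rule_format, OF base_point_in_toep base_point_in_toep]]
      by metis
    then have "f base_point = shift_iter t (root_shift k c base_point)"
      using root_shift_eq[OF base_point_in_toep, of k c 0] y(2)
      by (simp add: funpow_fill_base_point)
    then show ?thesis by blast
  qed
  then show ?thesis by blast
qed

theorem theorem1:
  shows "\<exists>(S :: nat set) X. finite S \<and> toeplitz_subshift S X \<and>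
    automorphism_group S X \<cong> subgroup_generated rational_group {(5 / 2) ^ i |i :: nat. True}"
proof -
  let ?A = "automorphism_group digits toep_closure"
  interpret group ?A
    by (rule group_automorphism_group[OF toeplitz_subshift_imp_subshift[OF toeplitz_subshift_toep]])
  have carrier: "f \<in> carrier ?A \<longleftrightarrow> f \<in> extensional toep_closure \<and> shift_automorphism digits toep_closure f"
    and mult: "f \<otimes>\<^bsub>?A\<^esub> g = compose toep_closure f g" and one: "\<one>\<^bsub>?A\<^esub> = (\<lambda>u\<in>toep_closure. u)" for f g
    by (simp_all add: automorphism_group_def)
  have endo: "shift_endomorphism digits toep_closure f" if "f \<in> carrier ?A" for f
    using that by (simp add: carrier shift_automorphism_def)
  have ext: "f = g" if "f \<in> carrier ?A" "g \<in> carrier ?A" "\<And>u. u \<in> toep_closure \<Longrightarrow> f u = g u" for f g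
    using that by (intro extensionalityI[of f toep_closure g]) (auto simp: carrier)
  have closed: "root_shift k c \<in> carrier ?A" for k c
    by (simp add: carrier root_shift_extensional root_shift_automorphism)
  have "?A \<cong> subgroup_generated rational_group {(5 / 2) ^ i |i :: nat. True}"
  proof (rule dyadic_roots_iso[of root_shift])
    show "root_shift k c \<in> carrier ?A" for k c by (rule closed)
    show "root_shift k (c + d) = root_shift k c \<otimes>\<^bsub>?A\<^esub> root_shift k d" for k c d
      by (rule ext[OF closed m_closed[OF closed closed]])
        (simp add: mult compose_eq root_shift_add)
    \<comment> \<open>Level 0 consists of the powers of the shift, which commute with every
      endomorphism.\<close>
    show "root_shift 0 c \<otimes>\<^bsub>?A\<^esub> f = f \<otimes>\<^bsub>?A\<^esub> root_shift 0 c" if f: "f \<in> carrier ?A" for f c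
    proof (rule ext)
      fix u :: "int \<Rightarrow> nat"
      assume u: "u \<in> toep_closure"
      then show "(root_shift 0 c \<otimes>\<^bsub>?A\<^esub> f) u = (f \<otimes>\<^bsub>?A\<^esub> root_shift 0 c) u"
        using endomorphism_in_toep[OF endo[OF f] u] endomorphism_shift_iter[OF endo[OF f] u]
        by (simp add: mult compose_eq root_shift_level_0)
    qed (intro m_closed closed f)+
    show "root_shift k (2 ^ k) = root_shift 0 (5 ^ k)" for k
      by (rule ext) (simp_all add: closed root_shift_root root_shift_level_0)
    show "c = 0" if "root_shift 0 c = \<one>\<^bsub>?A\<^esub>" for c
      using that root_shift_level_0[OF base_point_in_toep, of c] base_point_in_toep
      by (intro base_point_aperiodic) (simp add: one)
    show "\<exists>K. \<forall>k\<ge>K. \<exists>t c. f = root_shift 0 t \<otimes>\<^bsub>?A\<^esub> root_shift k c" if f: "f \<in> carrier ?A" for f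
    proof -
      \<comment> \<open>Agreement at the base point is enough, by
        \<open>endomorphism_eqI\<close>.\<close>
      have "f = root_shift 0 t \<otimes>\<^bsub>?A\<^esub> root_shift k c"
        if "f base_point = shift_iter t (root_shift k c base_point)" for k t c
      proof (rule ext[OF f])
        show prod: "root_shift 0 t \<otimes>\<^bsub>?A\<^esub> root_shift k c \<in> carrier ?A" by (simp add: closed)
        have "(root_shift 0 t \<otimes>\<^bsub>?A\<^esub> root_shift k c) base_point = f base_point"
          using that base_point_in_toep
          by (simp add: mult compose_eq root_shift_level_0 root_shift_in_toep)
        then show "f u = (root_shift 0 t \<otimes>\<^bsub>?A\<^esub> root_shift k c) u" if "u \<in> toep_closure" for u
          using endomorphism_eqI[OF endo[OF f] endo[OF prod] _ that] by simp
      qed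
      then show ?thesis using endomorphism_base_point[OF endo[OF f]] by meson
    qed
  qed
  then show ?thesis using toeplitz_subshift_toep by blast
qed

end
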